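(* For every countable ordinal $\xi\geq 1$, the metric space $(X_\xi,d_\xi)$ (defined in the context) satisfies $\operatorname{coasdim}(X_\xi)=\xi$ and $\operatorname{trasdim}(X_\xi)=\xi$.
   Context: Conventions: $\mathbb{N}=\{1,2,3,\dots\}$; $Fin\,\mathbb{N}$ is the collection of all finite nonempty subsets of $\mathbb{N}$. For subsets $U,V$ of a metric space $(X,d)$, $d(U,V)=\inf\{d(x,y): x\in U,y\in V\}$. A family $\mathcal{U}$ of subsets of $X$ is uniformly bounded if there is $R>0$ with $\operatorname{diam}U\le R$ for all $U\in\mathcal{U}$; for $r>0$ it is $r$-disjoint if $d(U,V)\ge r$ for all $U,V\in\mathcal{U}$ with $U\ne V$. $\bigcup\mathcal{U}$ denotes the union of the members of $\mathcal{U}$. Ord: for $M\subseteq Fin\,\mathbb{N}$ and $a\in\mathbb{N}$ let $M^{a}=\{\tau\in Fin\,\mathbb{N}: \tau\cup\{a\}\in M,\ a\notin\tau\}$. Define $\operatorname{Ord}M$ inductively: $\operatorname{Ord}M=0$ iff $M=\varnothing$; for an ordinal $\alpha>0$, $\operatorname{Ord}M\le\alpha$ iff $\operatorname{Ord}M^{a}<\alpha$ for every $a\in\mathbb{N}$; $\operatorname{Ord}M=\alpha$ iff $\operatorname{Ord}M\le\alpha$ and $\operatorname{Ord}M<\alpha$ is not true; $\operatorname{Ord}M=\infty$ iff $\operatorname{Ord}M\le\alpha$ holds for no ordinal $\alpha$. Transfinite asymptotic dimension: for a metric space $(X,d)$ let $A(X,d)$ be the set of all $\sigma\in Fin\,\mathbb{N}$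 such that there are no uniformly bounded families $\mathcal{U}_i$ ($i\in\sigma$) of subsets of $X$ with each $\mathcal{U}_i$ $i$-disjoint and $\bigcup_{i\in\sigma}\mathcal{U}_i$ covering $X$. Then $\operatorname{trasdim}(X)=\operatorname{Ord}A(X,d)$. Complementary-finite asymptotic dimension: every ordinal $\gamma$ is uniquely $\gamma=\lambda(\gamma)+n(\gamma)$ with $\lambda(\gamma)$ a limit ordinal or $0$ and $n(\gamma)\in\mathbb{N}\cup\{0\}$. Inductively: $\operatorname{coasdim}(X)=-1$ iff $X=\varnothing$; $\operatorname{coasdim}(X)\le\lambda(\gamma)+n(\gamma)$ iff for every $r>0$ there exist $r$-disjoint uniformly bounded families $\mathcal{U}_0,\dots,\mathcal{U}_{n(\gamma)}$ of subsets of $X$ with $\operatorname{coasdim}\bigl(X\setminus\bigcup\bigcup_{i=0}^{n(\gamma)}\mathcal{U}_i\bigr)<\lambda(\gamma)$; $\operatorname{coasdim}(X)=\gamma$ iff $\operatorname{coasdim}(X)\le\gamma$ and $\operatorname{coasdim}(X)\le\beta$ fails for every $\beta<\gamma$; $\operatorname{coasdim}(X)=\infty$ if $\operatorname{coasdim}(X)\le\gamma$ fails for every ordinal $\gamma$. The families $S_\xi$: elements of $\tau=\{k_0,\dots,k_s\}\in Fin\,\mathbb{N}$ are indexed so that $k_0<k_1<\dots<k_s$. For $n\in\mathbb{N}\cup\{0\}$ let $K(\tau,n)=\{k_{n+1},\dots,k_s\}$ if $n<s$ and $K(\tau,n)=\varnothing$ if $n\ge s$; let $i(\tau,n)=k_n$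 if $n\le s$ and $i(\tau,n)=k_s$ if $n>s$. For each countable limit ordinal $\alpha$ fix an increasing sequence $(\zeta_i(\alpha)+i)_{i\in\mathbb{N}}$ of ordinals with each $\zeta_i(\alpha)$ a limit ordinal or $0$ and $\alpha=\sup_i(\zeta_i(\alpha)+i)$; when $\alpha=\sup_i(\beta+i)$ for some limit ordinal $\beta$, take $\zeta_i(\alpha)=\beta$ for all $i$. Write a countable ordinal as $\xi=\gamma(\xi)+n(\xi)$ with $\gamma(\xi)$ a limit ordinal or $0$ and $n(\xi)\in\mathbb{N}\cup\{0\}$. Define by induction families $S_\xi\subseteq Fin\,\mathbb{N}$ for countable $\xi\ge1$: $S_n=\{\sigma\in Fin\,\mathbb{N}:|\sigma|\le n\}$ for $n\in\mathbb{N}$; for infinite $\xi$, $S_\xi$ is the set of $\sigma\in Fin\,\mathbb{N}$ such that, for some $l\in\{1,\dots,i(\sigma,n(\xi))\}$, either $K(\sigma,n(\xi))=\varnothing$ or $K(\sigma,n(\xi))\in S_{\zeta_l(\gamma(\xi))+l}$. Let $S_\xi[L]=\{\{k_0+2,\dots,k_s+2\}:\{k_0,\dots,k_s\}\in S_\xi\}$. The spaces: for $\tau=\{k_0+2,\dots,k_m+2\}\in S_\xi[L]$ ($k_0<\dots<k_m$) let $X_\tau=\{(x_i)_{i=0}^m\in(2^{k_0}\mathbb{Z})^{m+1}: |\{j: x_j\notin 2^{k_p}\mathbb{Z}\}|\le p \text{ for every } p\in\{0,1,\dots,m\}\}$ with the sup-metric. Let $\bigoplus\mathbb{Z}$ be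 the set of eventually zero integer sequences indexed by $\{0,1,2,\dots\}$ with sup-metric $\rho$, and let $i_\tau:X_\tau\to\bigoplus\mathbb{Z}$ be the isometric embedding extending $(x_0,\dots,x_m)$ by zeros. Let $X_\xi=\bigsqcup_{\tau\in S_\xi[L]}X_\tau$ (disjoint union) with the metric $d_\xi(x,y)=\rho(i_\tau(x),i_\tau(y))$ if $x,y\in X_\tau$, and $d_\xi(x,y)=\max\{s(\tau_1),s(\tau_2),\rho(i_{\tau_1}(x),i_{\tau_2}(y))\}$ if $x\in X_{\tau_1}$, $y\in X_{\tau_2}$, $\tau_1\ne\tau_2$, where $s(\sigma)=2^{\max\sigma}$. *)

theory Defs
  imports "HOL-Analysis.Analysis" "HOL-Library.Countable_Set_Type" "HOL-Library.Lub_Glb"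
begin

section \<open>Countable ordinals\<close>

text \<open>The ordinals below \<open>\<omega>\<^sub>1\<close>, that is, the countable ordinals: the cardinal successor
  of \<open>natLeq\<close> is a well-order of type \<open>\<omega>\<^sub>1\<close>.\<close>

typedef omega1 = "Field (cardSuc natLeq)"
proof -
  have "Field (cardSuc natLeq) \<noteq> {}"
    by (simp add: Field_cardSuc_not_empty natLeq_Card_order)
  then show ?thesis by blast
qed

setup_lifting type_definition_omega1

instantiation omega1 :: linorder
begin

lift_definition less_eq_omega1 :: "omega1 \<Rightarrow> omega1 \<Rightarrow> bool"
  is "\<lambda>a b. (a, b) \<in> cardSuc natLeq" .

definition less_omega1 :: "omega1 \<Rightarrow> omega1 \<Rightarrow> bool"
  where "less_omega1 a b \<longleftrightarrow> a \<le> b \<and> \<not> b \<le> a"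

lemma cardSuc_natLeq_Card_order: "Card_order (cardSuc natLeq)"
  by (simp add: cardSuc_Card_order natLeq_Card_order)

lemma cardSuc_natLeq_Well_order: "Well_order (cardSuc natLeq)"
  using cardSuc_natLeq_Card_order by (rule Card_order_wo_rel[unfolded wo_rel_def])

instance
proof
  have L: "Linear_order (cardSuc natLeq)"
    using cardSuc_natLeq_Well_order by (simp add: well_order_on_def)
  note D = L[unfolded linear_order_on_def partial_order_on_def preorder_on_def]
  fix x y z :: omega1
  show "(x < y) = (x \<le> y \<and> \<not> y \<le> x)" by (simp add: less_omega1_def)
  show "x \<le> x" using D by transfer (auto simp: refl_on_def)
  show "x \<le> y \<Longrightarrow> y \<le> z \<Longrightarrow> x \<le> z"
    using D by transfer (meson transD)
  show "x \<le> y \<Longrightarrow> y \<le> x \<Longrightarrow> x = y"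
    using D by transfer (meson antisymD)
  show "x \<le> y \<or> y \<le> x"
    using D by transfer (metis total_on_def refl_on_def)
qed

end

lemma less_omega1_iff:
  "a < b \<longleftrightarrow> (Rep_omega1 a, Rep_omega1 b) \<in> cardSuc natLeq - Id"
  unfolding less_le by (simp add: less_eq_omega1.rep_eq Rep_omega1_inject)

instance omega1 :: wellorder
proof
  fix P :: "omega1 \<Rightarrow> bool" and a :: omega1
  assume IH: "\<And>x. (\<And>y. y < x \<Longrightarrow> P y) \<Longrightarrow> P x"
  have "wf (cardSuc natLeq - Id)"
    using cardSuc_natLeq_Well_order by (simp add: well_order_on_def)
  then have "wf (inv_image (cardSuc natLeq - Id) Rep_omega1)" by (rule wf_inv_image)
  then show "P a"
  proof (induction a rule: wf_induct_rule)
    case (less x)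
    show ?case
    proof (rule IH)
      show "P y" if "y < x" for y
        using that by (intro less) (simp add: less_omega1_iff)
    qed
  qed
qed

instance omega1 :: no_top
proof
  fix x :: omega1
  have "infinite (Field (cardSuc natLeq))"
    using cardSuc_finite[OF natLeq_Card_order] Field_natLeq infinite_UNIV_nat by metis
  then obtain b where "b \<in> Field (cardSuc natLeq)" "Rep_omega1 x \<noteq> b"
      "(Rep_omega1 x, b) \<in> cardSuc natLeq"
    using infinite_Card_order_limit[OF cardSuc_natLeq_Card_order] Rep_omega1 by metis
  then have "x < Abs_omega1 b" by (simp add: less_omega1_iff Abs_omega1_inverse)
  then show "\<exists>y. x < y" ..
qed

context includes cardinal_syntax
begin

lemma countable_omega1_lessThan: "countable {..<a :: omega1}"
proof -
  have "|underS (cardSuc natLeq) (Rep_omega1 a)| <o cardSuc natLeq"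
    using card_of_underS[OF cardSuc_natLeq_Card_order Rep_omega1] .
  then have "|underS (cardSuc natLeq) (Rep_omega1 a)| \<le>o natLeq"
    by (rule iffD1[OF cardSuc_ordLeq_ordLess[OF natLeq_Card_order card_of_Card_order]])
  then have "countable (underS (cardSuc natLeq) (Rep_omega1 a))"
    by (simp only: countable_card_le_natLeq)
  moreover have "Rep_omega1 ` {..<a} \<subseteq> underS (cardSuc natLeq) (Rep_omega1 a)"
    by (auto simp: underS_def less_omega1_iff)
  ultimately have "countable (Rep_omega1 ` {..<a})" by (rule countable_subset[rotated])
  then show ?thesis
    by (rule countable_image_inj_on) (simp add: inj_on_def Rep_omega1_inject)
qed

lemma uncountable_omega1: "uncountable (UNIV :: omega1 set)"
proof
  assume "countable (UNIV :: omega1 set)"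
  then have "countable (range Rep_omega1)" by (rule countable_image)
  then have "countable (Field (cardSuc natLeq))"
    by (simp only: type_definition.Rep_range[OF type_definition_omega1])
  then have "|Field (cardSuc natLeq)| \<le>o natLeq"
    by (simp only: countable_card_le_natLeq)
  then have "cardSuc natLeq \<le>o natLeq"
    by (rule ordIso_ordLeq_trans[OF ordIso_symmetric[OF card_of_Field_ordIso
          [OF cardSuc_natLeq_Card_order]]])
  then show False
    using not_ordLess_ordLeq[OF cardSuc_greater[OF natLeq_Card_order]] by simp
qed

end


section \<open>Ordinal arithmetic\<close>

text \<open>Elements of a well-ordered type are used as ordinals (each stands for the order type
  of the set of its predecessors); the absence of a top element provides successors.\<close>

definition ord_zero :: "'o::wellorder"
  where "ord_zero = (LEAST a. True)"

definition ord_succ :: "'o::{wellorder,no_top} \<Rightarrow> 'o"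
  where "ord_succ a = (LEAST b. a < b)"

definition ord_plus :: "'o::{wellorder,no_top} \<Rightarrow> nat \<Rightarrow> 'o"
  where "ord_plus a n = (ord_succ ^^ n) a"

definition limit_ord :: "'o::{wellorder,no_top} \<Rightarrow> bool"
  where "limit_ord a \<longleftrightarrow> a \<noteq> ord_zero \<and> (\<forall>b. a \<noteq> ord_succ b)"

definition limit_part :: "'o::{wellorder,no_top} \<Rightarrow> 'o"
  where "limit_part a =
    (THE l. (l = ord_zero \<or> limit_ord l) \<and> (\<exists>n. a = ord_plus l n))"

definition finite_part :: "'o::{wellorder,no_top} \<Rightarrow> nat"
  where "finite_part a = (THE n. a = ord_plus (limit_part a) n)"

lemma ord_zero_le: "ord_zero \<le> (a :: 'o::wellorder)"
  unfolding ord_zero_def by (simp add: Least_le)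

lemma ord_succ_greater: "a < ord_succ (a :: 'o::{wellorder,no_top})"
  unfolding ord_succ_def using gt_ex[of a] by (rule LeastI_ex)

lemma ord_succ_le: "a < b \<Longrightarrow> ord_succ a \<le> (b :: 'o::{wellorder,no_top})"
  unfolding ord_succ_def by (rule Least_le)

lemma ord_succ_inject: "ord_succ a = ord_succ b \<longleftrightarrow> a = (b :: 'o::{wellorder,no_top})"
proof
  assume eq: "ord_succ a = ord_succ b"
  show "a = b"
  proof (rule linorder_cases[of a b])
    assume "a < b"
    then have "ord_succ a \<le> b" by (rule ord_succ_le)
    then show ?thesis using eq ord_succ_greater[of b] by simp
  next
    assume "b < a"
    then have "ord_succ b \<le> a" by (rule ord_succ_le)
    then show ?thesis using eq ord_succ_greater[of a] by simp
  qed
qed simp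

lemma ord_plus_0 [simp]: "ord_plus a 0 = a"
  by (simp add: ord_plus_def)

lemma ord_plus_Suc [simp]: "ord_plus a (Suc n) = ord_succ (ord_plus a n)"
  by (simp add: ord_plus_def)

lemma ord_plus_ge: "a \<le> ord_plus a n"
proof (induction n)
  case (Suc n)
  also have "ord_plus a n \<le> ord_plus a (Suc n)"
    using ord_succ_greater[of "ord_plus a n"] by simp
  finally show ?case .
qed simp

lemma limit_neq_succ:
  fixes a b :: "'o::{wellorder,no_top}"
  assumes "a = ord_zero \<or> limit_ord a"
  shows "a \<noteq> ord_succ b"
proof
  assume "a = ord_succ b"
  then have "a = ord_zero" using assms unfolding limit_ord_def by blast
  then show False
    using \<open>a = ord_succ b\<close> ord_zero_le[of b] ord_succ_greater[of b] by simp
qed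

lemma ord_plus_limit_unique:
  fixes l m :: "'o::{wellorder,no_top}"
  assumes "l = ord_zero \<or> limit_ord l" "m = ord_zero \<or> limit_ord m"
    and "ord_plus l i = ord_plus m j"
  shows "l = m \<and> i = j"
  using assms(3)
proof (induction i arbitrary: j)
  case 0
  then show ?case using limit_neq_succ[OF assms(1)] by (cases j) simp_all
next
  case (Suc i j)
  show ?case
  proof (cases j)
    case 0
    then show ?thesis using Suc.prems limit_neq_succ[OF assms(2), of "ord_plus l i"] by simp
  next
    case k: (Suc k)
    then have "ord_plus l i = ord_plus m k"
      using Suc.prems by (simp add: ord_succ_inject)
    then have "l = m \<and> i = k" by (rule Suc.IH)
    then show ?thesis using k by simp
  qed
qed

lemma ord_decomposition:
  fixes a :: "'o::{wellorder,no_top}"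
  shows "\<exists>l n. (l = ord_zero \<or> limit_ord l) \<and> a = ord_plus l n"
proof (induction a rule: less_induct)
  case (less a)
  show ?case
  proof (cases "a = ord_zero \<or> limit_ord a")
    case True
    then show ?thesis by (intro exI[of _ a] exI[of _ 0]) simp
  next
    case False
    then obtain b where "a = ord_succ b" by (auto simp: limit_ord_def)
    moreover from this obtain l n where "l = ord_zero \<or> limit_ord l" "b = ord_plus l n"
      using less[of b] ord_succ_greater by blast
    ultimately show ?thesis by (intro exI[of _ l] exI[of _ "Suc n"]) simp
  qed
qed

lemma limit_finite_part:
  fixes a :: "'o::{wellorder,no_top}"
  shows "limit_part a = ord_zero \<or> limit_ord (limit_part a)"
    and "ord_plus (limit_part a) (finite_part a) = a"
proof -
  have "\<exists>!l. (l = ord_zero \<or> limit_ord l) \<and> (\<exists>n. a = ord_plus l n)"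
  proof (rule ex_ex1I)
    show "\<exists>l. (l = ord_zero \<or> limit_ord l) \<and> (\<exists>n. a = ord_plus l n)"
      using ord_decomposition[of a] by blast
    show "l = l'" if l: "(l = ord_zero \<or> limit_ord l) \<and> (\<exists>n. a = ord_plus l n)"
      and l': "(l' = ord_zero \<or> limit_ord l') \<and> (\<exists>n. a = ord_plus l' n)" for l l'
    proof -
      from l obtain i where i: "a = ord_plus l i" by blast
      from l' obtain j where j: "a = ord_plus l' j" by blast
      from ord_plus_limit_unique[OF conjunct1[OF l] conjunct1[OF l'] trans[OF sym[OF i] j]]
      show ?thesis by (rule conjunct1)
    qed
  qed
  then have *: "(limit_part a = ord_zero \<or> limit_ord (limit_part a)) \<and>
      (\<exists>n. a = ord_plus (limit_part a) n)"
    unfolding limit_part_def by (rule theI')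
  then show "limit_part a = ord_zero \<or> limit_ord (limit_part a)" by blast
  have "\<exists>!n. a = ord_plus (limit_part a) n"
  proof (rule ex_ex1I)
    show "\<exists>n. a = ord_plus (limit_part a) n" using * by blast
    show "i = j" if "a = ord_plus (limit_part a) i" "a = ord_plus (limit_part a) j" for i j
      using ord_plus_limit_unique[OF conjunct1[OF *] conjunct1[OF *] trans[OF sym[OF that(1)] that(2)]]
      by (rule conjunct2)
  qed
  then have "a = ord_plus (limit_part a) (finite_part a)"
    unfolding finite_part_def by (rule theI')
  then show "ord_plus (limit_part a) (finite_part a) = a" by (rule sym)
qed

lemma limit_part_le: "limit_part a \<le> a"
  using ord_plus_ge[of "limit_part a" "finite_part a"] unfolding limit_finite_part(2) .


section \<open>Families of subsets of a metric space\<close>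

text \<open>The condition on \<open>U\<close> says \<open>diam U \<le> R\<close>, also for empty \<open>U\<close>.\<close>

definition uniformly_bounded :: "'a metric \<Rightarrow> 'a set set \<Rightarrow> bool"
  where "uniformly_bounded m \<U> \<longleftrightarrow>
    (\<exists>R>0. \<forall>U\<in>\<U>. \<forall>x\<in>U. \<forall>y\<in>U. mdist m x y \<le> R)"

text \<open>The innermost condition says \<open>d(U,V) \<ge> r\<close>, the infimum over the empty set being \<open>\<infinity>\<close>.\<close>

definition r_disjoint :: "'a metric \<Rightarrow> real \<Rightarrow> 'a set set \<Rightarrow> bool"
  where "r_disjoint m r \<U> \<longleftrightarrow>
    (\<forall>U\<in>\<U>. \<forall>V\<in>\<U>. U \<noteq> V \<longrightarrow> (\<forall>x\<in>U. \<forall>y\<in>V. r \<le> mdist m x y))"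


section \<open>Transfinite asymptotic dimension\<close>

text \<open>Here the positive integers play the role of \<open>\<nat>\<close>.\<close>

definition FinN :: "nat set set"
  where "FinN = {\<sigma>. finite \<sigma> \<and> \<sigma> \<noteq> {} \<and> 0 \<notin> \<sigma>}"

definition link_at :: "nat set set \<Rightarrow> nat \<Rightarrow> nat set set"
  where "link_at M a = {\<tau> \<in> FinN. \<tau> \<union> {a} \<in> M \<and> a \<notin> \<tau>}"

function Ord_le :: "nat set set \<Rightarrow> 'o::wellorder \<Rightarrow> bool"
  where "Ord_le M \<alpha> \<longleftrightarrow>
    (if \<alpha> = ord_zero then M = {}
     else \<forall>a\<ge>1. \<exists>\<beta>\<in>{..<\<alpha>}. Ord_le (link_at M a) \<beta>)"
  by auto
termination
  by (relation "inv_image {(x, y). x < y} snd") (auto intro: wf)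

declare Ord_le.simps [simp del]

definition has_Ord :: "nat set set \<Rightarrow> 'o::wellorder \<Rightarrow> bool"
  where "has_Ord M \<alpha> \<longleftrightarrow> Ord_le M \<alpha> \<and> \<not> (\<exists>\<beta><\<alpha>. Ord_le M \<beta>)"

definition A_set :: "'a metric \<Rightarrow> nat set set"
  where "A_set m = {\<sigma> \<in> FinN. \<not> (\<exists>\<U> :: nat \<Rightarrow> 'a set set.
    (\<forall>i\<in>\<sigma>. \<Union> (\<U> i) \<subseteq> mspace m \<and> uniformly_bounded m (\<U> i) \<and>
      r_disjoint m (real i) (\<U> i)) \<and>
    mspace m \<subseteq> (\<Union>i\<in>\<sigma>. \<Union> (\<U> i)))}"

definition has_trasdim :: "'a metric \<Rightarrow> 'o::wellorder \<Rightarrow> bool"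
  where "has_trasdim m \<alpha> \<longleftrightarrow> has_Ord (A_set m) \<alpha>"


section \<open>Complementary-finite asymptotic dimension\<close>

text \<open>The last two lines express that the complement \<open>Y\<close> has dimension less than
  \<open>limit_part \<gamma>\<close>: it has dimension \<open>-1\<close>, i.e. is empty, or dimension at most an
  ordinal below \<open>limit_part \<gamma>\<close>.\<close>

function coasdim_le :: "'a metric \<Rightarrow> 'o::{wellorder,no_top} \<Rightarrow> bool"
  where "coasdim_le m \<gamma> \<longleftrightarrow>
    (\<forall>r>0. \<exists>\<U> :: nat \<Rightarrow> 'a set set.
      (\<forall>i\<le>finite_part \<gamma>. \<Union> (\<U> i) \<subseteq> mspace m \<and> r_disjoint m r (\<U> i) \<and>
        uniformly_bounded m (\<U> i)) \<and>
      (let Y = submetric m (mspace m - (\<Union>i\<le>finite_part \<gamma>. \<Union> (\<U> i)))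
       in mspace Y = {} \<or> (\<exists>\<beta>\<in>{..<limit_part \<gamma>}. coasdim_le Y \<beta>)))"
  by auto
termination
  by (relation "inv_image {(x, y). x < y} snd")
    (auto intro: wf less_le_trans[OF _ limit_part_le])

declare coasdim_le.simps [simp del]

text \<open>An ordinal \<open>\<gamma>\<close> is the dimension if no smaller value, including \<open>-1\<close>, is an upper bound.\<close>

definition has_coasdim :: "'a metric \<Rightarrow> 'o::{wellorder,no_top} \<Rightarrow> bool"
  where "has_coasdim m \<gamma> \<longleftrightarrow>
    coasdim_le m \<gamma> \<and> \<not> (mspace m = {} \<or> (\<exists>\<beta><\<gamma>. coasdim_le m \<beta>))"


section \<open>The families $S_\xi$\<close>

definition K_part :: "nat set \<Rightarrow> nat \<Rightarrow> nat set"
  where "K_part \<tau> n = set (drop (n + 1) (sorted_list_of_set \<tau>))"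

definition i_part :: "nat set \<Rightarrow> nat \<Rightarrow> nat"
  where "i_part \<tau> n = (if n < card \<tau> then sorted_list_of_set \<tau> ! n else Max \<tau>)"

text \<open>Admissible choices of \<open>\<zeta>\<^sub>i(\<alpha>)\<close>, written \<open>\<zeta> \<alpha> i\<close>; only \<open>i \<ge> 1\<close> matters.\<close>

definition fundamental_seqs :: "(omega1 \<Rightarrow> nat \<Rightarrow> omega1) \<Rightarrow> bool"
  where "fundamental_seqs \<zeta> \<longleftrightarrow> (\<forall>\<alpha>. limit_ord \<alpha> \<longrightarrow>
    (\<forall>i\<ge>1. \<zeta> \<alpha> i = ord_zero \<or> limit_ord (\<zeta> \<alpha> i)) \<and>
    strict_mono_on {1..} (\<lambda>i. ord_plus (\<zeta> \<alpha> i) i) \<and>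
    isLub UNIV ((\<lambda>i. ord_plus (\<zeta> \<alpha> i) i) ` {1..}) \<alpha> \<and>
    (\<forall>\<beta>. limit_ord \<beta> \<and> isLub UNIV (ord_plus \<beta> ` {1..}) \<alpha> \<longrightarrow> (\<forall>i\<ge>1. \<zeta> \<alpha> i = \<beta>)))"

text \<open>The guard \<open>ord_plus (\<zeta> (limit_part \<xi>) l) l < \<xi>\<close> only serves to make the recursion on
  \<open>\<xi>\<close> terminate for arbitrary \<open>\<zeta>\<close>; it holds whenever \<open>fundamental_seqs \<zeta>\<close> (see below).
  The value at \<open>\<xi> = 0\<close> is the empty family and is never used.\<close>

function S_fam :: "(omega1 \<Rightarrow> nat \<Rightarrow> omega1) \<Rightarrow> omega1 \<Rightarrow> nat set set"
  where "S_fam \<zeta> \<xi> =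
    (if limit_part \<xi> = ord_zero then {\<sigma> \<in> FinN. card \<sigma> \<le> finite_part \<xi>}
     else {\<sigma> \<in> FinN. \<exists>l\<in>{1..i_part \<sigma> (finite_part \<xi>)}.
       K_part \<sigma> (finite_part \<xi>) = {} \<or>
       (if ord_plus (\<zeta> (limit_part \<xi>) l) l < \<xi>
        then K_part \<sigma> (finite_part \<xi>) \<in> S_fam \<zeta> (ord_plus (\<zeta> (limit_part \<xi>) l) l)
        else False)})"
  by auto
termination
  by (relation "inv_image {(x, y). x < y} snd") (auto intro: wf)

declare S_fam.simps [simp del]

lemma fundamental_seqs_guard:
  assumes "fundamental_seqs \<zeta>" and "limit_part \<xi> \<noteq> ord_zero" and "l \<ge> 1"
  shows "ord_plus (\<zeta> (limit_part \<xi>) l) l < \<xi>"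
proof -
  let ?a = "limit_part \<xi>" and ?f = "\<lambda>i. ord_plus (\<zeta> (limit_part \<xi>) i) i"
  have lim: "limit_ord ?a" using limit_finite_part(1) assms(2) by blast
  with assms(1) have "strict_mono_on {1..} ?f" and lub: "isLub UNIV (?f ` {1..}) ?a"
    unfolding fundamental_seqs_def by blast+
  then have "?f l < ?f (Suc l)"
    using assms(3) by (intro strict_mono_onD[of "{1..}" ?f]) auto
  also have "?f (Suc l) \<le> ?a"
    by (rule isUbD[OF isLub_isUb[OF lub]], rule imageI) simp
  also have "?a \<le> \<xi>" by (rule limit_part_le)
  finally show ?thesis .
qed

definition S_shift :: "(omega1 \<Rightarrow> nat \<Rightarrow> omega1) \<Rightarrow> omega1 \<Rightarrow> nat set set"
  where "S_shift \<zeta> \<xi> = (\<lambda>\<sigma>. (\<lambda>k. k + 2) ` \<sigma>) ` S_fam \<zeta> \<xi>"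


section \<open>The spaces $X_\xi$\<close>

text \<open>For \<open>\<tau> = {k\<^sub>0 + 2, \<dots>, k\<^sub>m + 2}\<close> the list \<open>[k\<^sub>0, \<dots>, k\<^sub>m]\<close>. Points of \<open>X\<^sub>\<tau>\<close> are lists
  of length \<open>m + 1\<close>.\<close>

definition k_list :: "nat set \<Rightarrow> nat list"
  where "k_list \<tau> = map (\<lambda>k. k - 2) (sorted_list_of_set \<tau>)"

definition X_tau :: "nat set \<Rightarrow> int list set"
  where "X_tau \<tau> = {x. length x = length (k_list \<tau>) \<and>
    (\<forall>j<length x. 2 ^ (k_list \<tau> ! 0) dvd x ! j) \<and>
    (\<forall>p<length x. card {j. j < length x \<and> \<not> 2 ^ (k_list \<tau> ! p) dvd x ! j} \<le> p)}"

text \<open>The sup-metric, meant for eventually zero sequences.\<close>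

definition rho :: "(nat \<Rightarrow> int) \<Rightarrow> (nat \<Rightarrow> int) \<Rightarrow> real"
  where "rho u v = (SUP i. \<bar>real_of_int (u i - v i)\<bar>)"

definition i_emb :: "int list \<Rightarrow> nat \<Rightarrow> int"
  where "i_emb x = (\<lambda>i. if i < length x then x ! i else 0)"

definition X_carrier :: "(omega1 \<Rightarrow> nat \<Rightarrow> omega1) \<Rightarrow> omega1 \<Rightarrow> (nat set \<times> int list) set"
  where "X_carrier \<zeta> \<xi> = (SIGMA \<tau>:S_shift \<zeta> \<xi>. X_tau \<tau>)"

definition s_val :: "nat set \<Rightarrow> real"
  where "s_val \<sigma> = 2 ^ Max \<sigma>"

fun X_dist :: "nat set \<times> int list \<Rightarrow> nat set \<times> int list \<Rightarrow> real"
  where "X_dist (\<tau>1, x) (\<tau>2, y) =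
    (if \<tau>1 = \<tau>2 then rho (i_emb x) (i_emb y)
     else max (s_val \<tau>1) (max (s_val \<tau>2) (rho (i_emb x) (i_emb y))))"

lemma finite_rho_range: "finite (range (\<lambda>i. \<bar>real_of_int (i_emb x i - i_emb y i)\<bar>))"
proof (rule finite_subset)
  show "range (\<lambda>i. \<bar>real_of_int (i_emb x i - i_emb y i)\<bar>) \<subseteq>
      insert 0 ((\<lambda>i. \<bar>real_of_int (i_emb x i - i_emb y i)\<bar>) ` {..<length x + length y})"
  proof (rule image_subsetI)
    fix i
    show "\<bar>real_of_int (i_emb x i - i_emb y i)\<bar> \<in>
        insert 0 ((\<lambda>i. \<bar>real_of_int (i_emb x i - i_emb y i)\<bar>) ` {..<length x + length y})"
    proof (cases "i < length x + length y")
      case False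
      then have "i_emb x i = 0" "i_emb y i = 0" by (simp_all add: i_emb_def)
      then show ?thesis by simp
    qed blast
  qed
qed simp

lemma rho_ge: "\<bar>real_of_int (i_emb x i - i_emb y i)\<bar> \<le> rho (i_emb x) (i_emb y)"
  unfolding rho_def
  by (rule cSUP_upper) (rule UNIV_I, rule bdd_above_finite, rule finite_rho_range)

lemma rho_le:
  "(\<And>i. \<bar>real_of_int (i_emb x i - i_emb y i)\<bar> \<le> c) \<Longrightarrow> rho (i_emb x) (i_emb y) \<le> c"
  unfolding rho_def by (rule cSUP_least) auto

lemma rho_nonneg: "0 \<le> rho (i_emb x) (i_emb y)"
  using rho_ge[of x 0 y] by linarith

lemma rho_commute: "rho (i_emb x) (i_emb y) = rho (i_emb y) (i_emb x)"
  unfolding rho_def by (simp add: abs_minus_commute)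

lemma rho_triangle:
  "rho (i_emb x) (i_emb z) \<le> rho (i_emb x) (i_emb y) + rho (i_emb y) (i_emb z)"
proof (rule rho_le)
  fix i
  show "\<bar>real_of_int (i_emb x i - i_emb z i)\<bar> \<le>
      rho (i_emb x) (i_emb y) + rho (i_emb y) (i_emb z)"
    using rho_ge[of x i y] rho_ge[of y i z] by simp
qed

lemma rho_eq_0:
  assumes "length x = length y"
  shows "rho (i_emb x) (i_emb y) = 0 \<longleftrightarrow> x = y"
proof
  assume *: "rho (i_emb x) (i_emb y) = 0"
  have "i_emb x i = i_emb y i" for i
    using rho_ge[of x i y] * by simp
  then show "x = y"
    using assms unfolding i_emb_def by (intro nth_equalityI) (simp, metis)
next
  show "x = y \<Longrightarrow> rho (i_emb x) (i_emb y) = 0" by (simp add: rho_def)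
qed

lemma Metric_space_X: "Metric_space (X_carrier \<zeta> \<xi>) X_dist"
proof
  fix a b c :: "nat set \<times> int list"
  obtain s x t y u z where abc [simp]: "a = (s, x)" "b = (t, y)" "c = (u, z)"
    by (metis surj_pair)
  have pos: "0 < s_val \<sigma>" for \<sigma> by (simp add: s_val_def)
  show "0 \<le> X_dist a b"
    using rho_nonneg[of x y] by (auto simp: le_max_iff_disj)
  show "X_dist a b = X_dist b a"
    using rho_commute[of x y] by (simp add: max.left_commute)
  show "X_dist a b = 0 \<longleftrightarrow> a = b" if "a \<in> X_carrier \<zeta> \<xi>" "b \<in> X_carrier \<zeta> \<xi>"
  proof (cases "s = t")
    case True
    then have "length x = length y"
      using that by (simp add: X_carrier_def X_tau_def)
    then show ?thesis using True rho_eq_0 by simp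
  next
    case False
    then show ?thesis using pos[of s] by (auto simp: max_def)
  qed
  show "X_dist a c \<le> X_dist a b + X_dist b c"
    using rho_triangle[of x z y] rho_nonneg[of x y] rho_nonneg[of y z]
      pos[of s] pos[of t] pos[of u]
    by (cases "s = t"; cases "t = u"; cases "s = u") (simp_all, linarith+)
qed

definition X_space :: "(omega1 \<Rightarrow> nat \<Rightarrow> omega1) \<Rightarrow> omega1 \<Rightarrow> (nat set \<times> int list) metric"
  where "X_space \<zeta> \<xi> = metric (X_carrier \<zeta> \<xi>, X_dist)"

lemma mspace_X_space [simp]: "mspace (X_space \<zeta> \<xi>) = X_carrier \<zeta> \<xi>"
  and mdist_X_space [simp]: "mdist (X_space \<zeta> \<xi>) = X_dist"
  unfolding X_space_def
  by (simp_all add: Metric_space.mspace_metric Metric_space.mdist_metric Metric_space_X)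

end

theory Submission
  imports Defs
begin

text \<open>
  In general \<open>trasdim \<le> coasdim\<close>, by induction on \<open>\<gamma> = \<lambda> + n\<close>: linking \<open>A(X)\<close> at \<open>n + 1\<close> numbers
  below \<open>r\<close> amounts to having \<open>n + 1\<close> many \<open>r\<close>-disjoint families at one's disposal, so what is left
  is contained in \<open>A(Y)\<close> for a complement \<open>Y\<close> of dimension below \<open>\<lambda>\<close>. It remains to show
  \<open>coasdim X\<^sub>\<xi> \<le> \<xi>\<close> and \<open>\<xi> \<le> trasdim X\<^sub>\<xi>\<close>.

  For the lower bound, \<open>{2^(k+1) : k \<in> \<sigma>} \<in> A(X\<^sub>\<xi>)\<close> for \<open>\<sigma> \<in> S\<^sub>\<xi>\<close>, and these sets already have
  \<open>Ord \<ge> \<xi>\<close>. If families as in the definition of \<open>A\<close> covered \<open>X\<^sub>\<tau>\<close>, one would treat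
  the scales in decreasing order: at scale \<open>2^k\<^sub>j\<close> the grid cells split into those near
  members of the \<open>j\<close>-th family on the low side of direction \<open>j\<close> and the others, and the common boundary
  of the two parts is a separator that avoids the \<open>j\<close>-th family and lies in the \<open>j\<close>-skeleton. The nested
  separators have a common point by Kuhn's lemma, which lies in \<open>X\<^sub>\<tau>\<close> but in no family.

  For the upper bound, given \<open>r\<close> and \<open>\<xi> = \<lambda> + n\<close>, the components \<open>X\<^sub>\<tau>\<close> whose \<open>n\<close>-th index is large lie in
  the \<open>n\<close>-skeleton of a coarse grid and are covered uniformly by \<open>n + 1\<close> families. All others arise from
  finitely many \<open>S\<^sub>\<beta>\<close> with \<open>\<beta> < \<lambda>\<close> by adding boundedly many indices, which costs only a finite
  summand in the dimension.
\<close>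

section \<open>Ordinals and the order of families of finite sets\<close>

lemma ord_succ_le_iff: "ord_succ a \<le> b \<longleftrightarrow> a < (b :: 'o::{wellorder,no_top})"
  by (auto intro: ord_succ_le less_le_trans[OF ord_succ_greater])

lemma less_ord_succ_iff: "a < ord_succ b \<longleftrightarrow> a \<le> (b :: 'o::{wellorder,no_top})"
  using ord_succ_le_iff[of b a] by auto

lemma limit_ord_plus_less:
  fixes a l :: "'o::{wellorder,no_top}"
  assumes "limit_ord l" "a < l"
  shows "ord_plus a n < l"
proof (induction n)
  case (Suc n)
  then have "ord_succ (ord_plus a n) \<le> l" by (rule ord_succ_le)
  moreover have "ord_succ (ord_plus a n) \<noteq> l"
    using limit_neq_succ[of l] assms(1) by metis
  ultimately show ?case by simp
qed (simp add: assms)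

lemma limit_part_unique:
  fixes l :: "'o::{wellorder,no_top}"
  assumes "l = ord_zero \<or> limit_ord l"
  shows "limit_part (ord_plus l n) = l" "finite_part (ord_plus l n) = n"
  using ord_plus_limit_unique[OF limit_finite_part(1) assms limit_finite_part(2)] by auto

section \<open>The bound Ord M \<le> \<alpha> under inclusions and iterated links\<close>

lemma Ord_le_zero: "Ord_le M (ord_zero :: 'o::wellorder) \<longleftrightarrow> M = {}"
  by (simp add: Ord_le.simps)

lemma Ord_le_pos:
  "\<alpha> \<noteq> ord_zero \<Longrightarrow> Ord_le M \<alpha> \<longleftrightarrow> (\<forall>a\<ge>1. \<exists>\<beta><\<alpha>. Ord_le (link_at M a) \<beta>)"
  by (subst Ord_le.simps) (auto simp: Bex_def)

lemma Ord_le_subset: "Ord_le N \<alpha> \<Longrightarrow> M \<subseteq> N \<Longrightarrow> Ord_le M \<alpha>"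
proof (induction \<alpha> arbitrary: M N rule: less_induct)
  case (less \<alpha>)
  show ?case
  proof (cases "\<alpha> = ord_zero")
    case True
    then show ?thesis using less.prems by (simp add: Ord_le_zero)
  next
    case False
    have "\<exists>\<beta><\<alpha>. Ord_le (link_at M a) \<beta>" if "a \<ge> 1" for a
    proof -
      obtain \<beta> where "\<beta> < \<alpha>" "Ord_le (link_at N a) \<beta>"
        using less.prems(1) \<open>a \<ge> 1\<close> unfolding Ord_le_pos[OF False] by blast
      moreover have "link_at M a \<subseteq> link_at N a" using less.prems(2) by (auto simp: link_at_def)
      ultimately show ?thesis using less.IH by blast
    qed
    then show ?thesis unfolding Ord_le_pos[OF False] by blast
  qed
qed

lemma Ord_le_empty: "Ord_le {} (\<alpha> :: 'o::wellorder)"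
proof (cases "\<alpha> = ord_zero")
  case False
  then have "ord_zero < \<alpha>" using ord_zero_le[of \<alpha>] by simp
  moreover have "link_at {} a = {}" for a by (simp add: link_at_def)
  ultimately show ?thesis unfolding Ord_le_pos[OF False] by (auto simp: Ord_le_zero)
qed (simp add: Ord_le_zero)

lemma Ord_le_succ:
  assumes "\<And>a. a \<ge> 1 \<Longrightarrow> Ord_le (link_at M a) \<alpha>"
  shows "Ord_le M (ord_succ \<alpha> :: 'o::{wellorder,no_top})"
proof -
  have "ord_succ \<alpha> \<noteq> ord_zero" using ord_zero_le[of \<alpha>] ord_succ_greater[of \<alpha>] by auto
  then show ?thesis using assms ord_succ_greater by (auto simp: Ord_le_pos)
qed

text \<open>Every link removes one element, so after \<open>n\<close> links only the empty set could
  remain, and \<open>FinN\<close> excludes it.\<close>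

lemma Ord_le_card:
  assumes "M \<subseteq> FinN" "\<And>\<sigma>. \<sigma> \<in> M \<Longrightarrow> card \<sigma> \<le> n"
  shows "Ord_le M (ord_plus ord_zero n :: 'o::{wellorder,no_top})"
  using assms
proof (induction n arbitrary: M)
  case 0
  then have "M = {}" by (force simp: FinN_def)
  then show ?case by (simp add: Ord_le_zero)
next
  case (Suc n)
  have "Ord_le (link_at M a) (ord_plus ord_zero n :: 'o)" if "a \<ge> 1" for a
  proof (rule Suc.IH)
    fix \<tau> assume "\<tau> \<in> link_at M a"
    then have "\<tau> \<union> {a} \<in> M" "a \<notin> \<tau>" "finite \<tau>" by (auto simp: link_at_def FinN_def)
    then show "card \<tau> \<le> n" using Suc.prems(2) by force
  qed (auto simp: link_at_def)
  then show ?case by (simp add: Ord_le_succ)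
qed

text \<open>For \<sigma> in \<open>FinN\<close> this is the result of applying
  \<open>link_at\<close> at its elements one after the other.\<close>

definition link_set :: "nat set set \<Rightarrow> nat set \<Rightarrow> nat set set"
  where "link_set M \<sigma> = {\<tau> \<in> FinN. \<tau> \<union> \<sigma> \<in> M \<and> \<tau> \<inter> \<sigma> = {}}"

text \<open>Each of the first \<open>n\<close> links lowers the bound by one, from
  \<open>l + n\<close> down to \<open>l\<close>; at \<open>l\<close> a further link has to fall
  strictly below \<open>l\<close>. This is why \<sigma> has \<open>Suc n\<close> elements.\<close>

lemma Ord_le_link_set:
  fixes l :: "'o::{wellorder,no_top}"
  assumes "l \<noteq> ord_zero"
    and "\<And>\<sigma>. \<sigma> \<in> FinN \<Longrightarrow> card \<sigma> = Suc n \<Longrightarrow> \<exists>\<beta><l. Ord_le (link_set M \<sigma>) \<beta>"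
  shows "Ord_le M (ord_plus l n)"
  using assms(2)
proof (induction n arbitrary: M)
  case 0
  have "\<exists>\<beta><l. Ord_le (link_at M a) \<beta>" if "a \<ge> 1" for a
  proof -
    have "link_set M {a} = link_at M a" by (auto simp: link_set_def link_at_def)
    then show ?thesis using 0[of "{a}"] that by (simp add: FinN_def)
  qed
  then show ?case by (simp add: Ord_le_pos[OF assms(1)])
next
  case (Suc n)
  have "Ord_le (link_at M a) (ord_plus l n)" if "a \<ge> 1" for a
  proof (rule Suc.IH)
    fix \<sigma> :: "nat set" assume \<sigma>: "\<sigma> \<in> FinN" "card \<sigma> = Suc n"
    show "\<exists>\<beta><l. Ord_le (link_set (link_at M a) \<sigma>) \<beta>"
    \<comment> \<open>Members of the link at \<open>a\<close> omit \<open>a\<close>, so linking at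
      \<open>a\<close> again leaves nothing.\<close>
    proof (cases "a \<in> \<sigma>")
      case True
      then have "link_set (link_at M a) \<sigma> = {}" by (auto simp: link_set_def link_at_def)
      moreover have "ord_zero < l" using assms(1) ord_zero_le[of l] by simp
      ultimately show ?thesis using Ord_le_empty by auto
    next
      case False
      then have "insert a \<sigma> \<in> FinN" "card (insert a \<sigma>) = Suc (Suc n)"
        using \<sigma> that by (auto simp: FinN_def)
      then obtain \<beta> where "\<beta> < l" "Ord_le (link_set M (insert a \<sigma>)) \<beta>"
        using Suc.prems by blast
      moreover have "link_set (link_at M a) \<sigma> \<subseteq> link_set M (insert a \<sigma>)"
        by (auto simp: link_set_def link_at_def)
      ultimately show ?thesis using Ord_le_subset by blast
    qed
  qed
  then show ?case by (simp add: Ord_le_succ)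
qed

section \<open>Transfinite and complementary-finite asymptotic dimension\<close>

lemma r_disjoint_mono: "r_disjoint m r \<U> \<Longrightarrow> s \<le> r \<Longrightarrow> r_disjoint m s \<U>"
  unfolding r_disjoint_def by (meson order_trans)

lemma empty_family [simp]: "r_disjoint m r {}" "uniformly_bounded m {}"
  by (auto simp: r_disjoint_def uniformly_bounded_def intro: exI[of _ 1])

text \<open>As \<open>r\<close> dominates all indices in \<sigma>, the \<open>Suc n\<close> families
  \<U> can serve as the families indexed by \<sigma>; the families \<V> indexed by \<tau> then only
  have to cover the rest.\<close>

lemma not_in_A_setI:
  assumes \<sigma>: "finite \<sigma>" "card \<sigma> = Suc n" and disj: "\<tau> \<inter> \<sigma> = {}"
    and r: "\<And>i. i \<in> \<sigma> \<Longrightarrow> real i \<le> r"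
    and \<U>: "\<And>i. i \<le> n \<Longrightarrow> \<Union> (\<U> i) \<subseteq> mspace m \<and> r_disjoint m r (\<U> i) \<and> uniformly_bounded m (\<U> i)"
    and \<V>: "\<And>i. i \<in> \<tau> \<Longrightarrow> \<Union> (\<V> i) \<subseteq> mspace m \<and> r_disjoint m (real i) (\<V> i) \<and> uniformly_bounded m (\<V> i)"
    and cover: "mspace m - (\<Union>i\<le>n. \<Union> (\<U> i)) \<subseteq> (\<Union>i\<in>\<tau>. \<Union> (\<V> i))"
  shows "\<tau> \<union> \<sigma> \<notin> A_set m"
proof -
  obtain h where "bij_betw h {0..<card \<sigma>} \<sigma>" using ex_bij_betw_nat_finite[OF \<sigma>(1)] by blast
  \<comment> \<open>\<open>d\<close> numbers the elements of \<sigma> by \<open>0..n\<close> and so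
    distributes \<U> over \<sigma>.\<close>
  then obtain d where d: "bij_betw d \<sigma> {0..<Suc n}" using bij_betw_inv \<sigma>(2) by metis
  have d_le: "d i \<le> n" if "i \<in> \<sigma>" for i using bij_betwE[OF d] that by auto
  define \<W> where "\<W> i = (if i \<in> \<sigma> then \<U> (d i) else \<V> i)" for i
  have "\<Union> (\<W> i) \<subseteq> mspace m \<and> uniformly_bounded m (\<W> i) \<and> r_disjoint m (real i) (\<W> i)"
    if "i \<in> \<tau> \<union> \<sigma>" for i
  proof (cases "i \<in> \<sigma>")
    case True
    then show ?thesis using \<U>[OF d_le[OF True]] r[OF True] by (auto simp: \<W>_def intro: r_disjoint_mono)
  qed (use that \<V> in \<open>auto simp: \<W>_def\<close>)
  moreover have "mspace m \<subseteq> (\<Union>i\<in>\<tau> \<union> \<sigma>. \<Union> (\<W> i))"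
  proof
    fix x assume x: "x \<in> mspace m"
    show "x \<in> (\<Union>i\<in>\<tau> \<union> \<sigma>. \<Union> (\<W> i))"
    proof (cases "x \<in> (\<Union>i\<le>n. \<Union> (\<U> i))")
      case True
      then obtain p where p: "p \<le> n" "x \<in> \<Union> (\<U> p)" by blast
      then have "p \<in> d ` \<sigma>" using bij_betw_imp_surj_on[OF d] by simp
      then obtain i where "i \<in> \<sigma>" "d i = p" by blast
      then show ?thesis using p by (auto simp: \<W>_def intro!: bexI[of _ i])
    next
      case False
      then obtain i where "i \<in> \<tau>" "x \<in> \<Union> (\<V> i)" using x cover by blast
      then show ?thesis using disj by (auto simp: \<W>_def intro!: bexI[of _ i])
    qed
  qed
  ultimately show ?thesis unfolding A_set_def by blast
qed

text \<open>If the limit part is \<open>0\<close>, the claim is a bound on the size of the members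
  of \<open>A_set m\<close>. Otherwise \<open>Ord_le_link_set\<close> reduces it to links at
  \<open>n + 1\<close> numbers, and these are controlled by the induction hypothesis for the
  complement \<open>Y\<close>.\<close>

theorem coasdim_le_imp_Ord_le:
  fixes \<gamma> :: "'o::{wellorder,no_top}"
  shows "coasdim_le m \<gamma> \<Longrightarrow> Ord_le (A_set m) \<gamma>"
proof (induction \<gamma> arbitrary: m rule: less_induct)
  case (less \<gamma>)
  define l n where "l = limit_part \<gamma>" and "n = finite_part \<gamma>"
  have \<gamma>: "ord_plus l n = \<gamma>" unfolding l_def n_def by (rule limit_finite_part(2))
  have ex: "\<exists>\<U>. (\<forall>i\<le>n. \<Union> (\<U> i) \<subseteq> mspace m \<and> r_disjoint m r (\<U> i) \<and> uniformly_bounded m (\<U> i)) \<and>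
      (mspace m \<subseteq> (\<Union>i\<le>n. \<Union> (\<U> i)) \<or>
        (\<exists>\<beta><l. coasdim_le (submetric m (mspace m - (\<Union>i\<le>n. \<Union> (\<U> i)))) \<beta>))" if "r > 0" for r
  proof -
    have *: "mspace (submetric m (mspace m - X)) = {} \<longleftrightarrow> mspace m \<subseteq> X" for X
      unfolding mspace_submetric by blast
    show ?thesis
      using less.prems[unfolded coasdim_le.simps[of m \<gamma>] Let_def, folded l_def n_def, rule_format, OF that]
      unfolding * Bex_def lessThan_iff .
  qed
  have bound: "(\<forall>i\<in>\<sigma>. real i \<le> real (Max \<sigma>)) \<and> 0 < real (Max \<sigma>)" if "\<sigma> \<in> FinN" for \<sigma>
  proof -
    have "finite \<sigma>" "Max \<sigma> \<in> \<sigma>" "0 \<notin> \<sigma>" using that by (auto simp: FinN_def)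
    moreover from this have "Max \<sigma> \<noteq> 0" by metis
    ultimately show ?thesis by simp
  qed
  show ?case
  proof (cases "l = ord_zero")
    case True
    have "card \<sigma> \<le> n" if \<sigma>: "\<sigma> \<in> A_set m" for \<sigma>
    proof (rule ccontr)
      assume "\<not> card \<sigma> \<le> n"
      then have "Suc n \<le> card \<sigma>" by simp
      \<comment> \<open>The indices in \<sigma>' receive the \<open>n + 1\<close> covering families,
        all other indices of \<sigma> the empty family.\<close>
      then obtain \<sigma>' where \<sigma>': "\<sigma>' \<subseteq> \<sigma>" "card \<sigma>' = Suc n" "finite \<sigma>'"
        by (rule obtain_subset_with_card_n)
      have fin: "\<sigma> \<in> FinN" using \<sigma> by (simp add: A_set_def)
      from bound[OF fin] have "0 < real (Max \<sigma>)" ..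
      \<comment> \<open>No ordinal lies below \<open>l = 0\<close>, so the families cover the whole
        space.\<close>
      from ex[OF this] obtain \<U> where \<U>: "\<forall>i\<le>n. \<Union> (\<U> i) \<subseteq> mspace m \<and>
          r_disjoint m (real (Max \<sigma>)) (\<U> i) \<and> uniformly_bounded m (\<U> i)"
        "mspace m \<subseteq> (\<Union>i\<le>n. \<Union> (\<U> i))"
        unfolding True using leD[OF ord_zero_le] by (elim exE conjE disjE) auto
      have "(\<sigma> - \<sigma>') \<union> \<sigma>' \<notin> A_set m"
      proof (rule not_in_A_setI[where \<V> = "\<lambda>_. {}"])
        show "\<And>i. i \<in> \<sigma>' \<Longrightarrow> real i \<le> real (Max \<sigma>)" using bound[OF fin] \<sigma>'(1) by blast
        show "\<And>i. i \<le> n \<Longrightarrow> \<Union> (\<U> i) \<subseteq> mspace m \<and> r_disjoint m (real (Max \<sigma>)) (\<U> i) \<and>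
          uniformly_bounded m (\<U> i)" using \<U>(1) by blast
        show "mspace m - (\<Union>i\<le>n. \<Union> (\<U> i)) \<subseteq> (\<Union>i\<in>\<sigma> - \<sigma>'. \<Union> {})"
          using \<U>(2) by blast
      qed (use \<sigma>' in auto)
      then show False using \<sigma> \<sigma>'(1) by (simp add: Un_absorb2)
    qed
    moreover have "A_set m \<subseteq> FinN" by (auto simp: A_set_def)
    ultimately have "Ord_le (A_set m) (ord_plus (ord_zero :: 'o) n)" by (intro Ord_le_card)
    then show ?thesis using True \<gamma> by simp
  next
    case False
    have "\<exists>\<beta><l. Ord_le (link_set (A_set m) \<sigma>) \<beta>" if \<sigma>: "\<sigma> \<in> FinN" "card \<sigma> = Suc n" for \<sigma>
    proof -
      \<comment> \<open>With the largest index as scale, \<open>r\<close>-disjoint families are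
        \<open>i\<close>-disjoint for every \<open>i\<close> in \<sigma>.\<close>
      define r where "r = real (Max \<sigma>)"
      have r: "\<And>i. i \<in> \<sigma> \<Longrightarrow> real i \<le> r" "0 < r" using bound[OF \<sigma>(1)] by (auto simp: r_def)
      have fin: "finite \<sigma>" using \<sigma>(1) by (simp add: FinN_def)
      obtain \<U> where \<U>: "\<forall>i\<le>n. \<Union> (\<U> i) \<subseteq> mspace m \<and> r_disjoint m r (\<U> i) \<and>
          uniformly_bounded m (\<U> i)"
        and or: "mspace m \<subseteq> (\<Union>i\<le>n. \<Union> (\<U> i)) \<or>
          (\<exists>\<beta><l. coasdim_le (submetric m (mspace m - (\<Union>i\<le>n. \<Union> (\<U> i)))) \<beta>)"
        using ex[OF r(2)] by (elim exE conjE)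
      define Y where "Y = submetric m (mspace m - (\<Union>i\<le>n. \<Union> (\<U> i)))"
      have Y: "mspace Y = mspace m - (\<Union>i\<le>n. \<Union> (\<U> i))" "mdist Y = mdist m"
        by (auto simp: Y_def)
      have Y_eq: "r_disjoint Y = r_disjoint m" "uniformly_bounded Y = uniformly_bounded m"
        by (simp_all add: fun_eq_iff r_disjoint_def uniformly_bounded_def Y(2))
      \<comment> \<open>Families witnessing that \<tau> is not in \<open>A_set Y\<close> would,
        together with \<U>, cover the whole space and exclude \<tau> \<union> \<sigma> from
        \<open>A_set m\<close>.\<close>
      have "link_set (A_set m) \<sigma> \<subseteq> A_set Y"
      proof
        fix \<tau> assume \<tau>: "\<tau> \<in> link_set (A_set m) \<sigma>"
        then have \<tau>F: "\<tau> \<in> FinN" by (simp add: link_set_def)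
        show "\<tau> \<in> A_set Y"
        proof (rule ccontr)
          assume "\<tau> \<notin> A_set Y"
          then have "\<exists>\<V>. (\<forall>i\<in>\<tau>. \<Union> (\<V> i) \<subseteq> mspace Y \<and> uniformly_bounded Y (\<V> i) \<and>
              r_disjoint Y (real i) (\<V> i)) \<and> mspace Y \<subseteq> (\<Union>i\<in>\<tau>. \<Union> (\<V> i))"
            using \<tau>F unfolding A_set_def by (simp only: mem_Collect_eq not_not simp_thms)
          then obtain \<V> where \<V>: "\<forall>i\<in>\<tau>. \<Union> (\<V> i) \<subseteq> mspace Y \<and>
              uniformly_bounded Y (\<V> i) \<and> r_disjoint Y (real i) (\<V> i)"
            "mspace Y \<subseteq> (\<Union>i\<in>\<tau>. \<Union> (\<V> i))"
            by (elim exE conjE)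
          have "\<tau> \<union> \<sigma> \<notin> A_set m"
          proof (rule not_in_A_setI[OF fin \<sigma>(2) _ r(1)])
            show "\<Union> (\<V> i) \<subseteq> mspace m \<and> r_disjoint m (real i) (\<V> i) \<and> uniformly_bounded m (\<V> i)"
              if "i \<in> \<tau>" for i
              using bspec[OF \<V>(1) that] unfolding Y_eq Y(1) by blast
            show "\<tau> \<inter> \<sigma> = {}" using \<tau> by (simp add: link_set_def)
            show "mspace m - (\<Union>i\<le>n. \<Union> (\<U> i)) \<subseteq> (\<Union>i\<in>\<tau>. \<Union> (\<V> i))" using \<V>(2) Y(1) by simp
            show "\<Union> (\<U> i) \<subseteq> mspace m \<and> r_disjoint m r (\<U> i) \<and> uniformly_bounded m (\<U> i)"
              if "i \<le> n" for i using \<U> that by simp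
          qed
          then show False using \<tau> by (simp add: link_set_def)
        qed
      qed
      moreover have "\<exists>\<beta><l. Ord_le (A_set Y) \<beta>"
        using or
      proof
        assume "mspace m \<subseteq> (\<Union>i\<le>n. \<Union> (\<U> i))"
        then have "mspace Y = {}" using Y by auto
        then have "A_set Y = {}" by (auto simp: A_set_def intro!: exI[of _ "\<lambda>_. {}"])
        moreover have "ord_zero < l" using False ord_zero_le[of l] by simp
        ultimately show ?thesis using Ord_le_empty by auto
      next
        assume "\<exists>\<beta><l. coasdim_le (submetric m (mspace m - (\<Union>i\<le>n. \<Union> (\<U> i)))) \<beta>"
        then obtain \<beta> where \<beta>: "\<beta> < l" "coasdim_le Y \<beta>" by (auto simp: Y_def)
        have "\<beta> < \<gamma>" using \<beta>(1) limit_part_le[of \<gamma>] by (auto simp: l_def)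
        from less.IH[OF this \<beta>(2)] show ?thesis using \<beta>(1) by blast
      qed
      ultimately show ?thesis using Ord_le_subset by blast
    qed
    then have "Ord_le (A_set m) (ord_plus l n)" by (rule Ord_le_link_set[OF False])
    then show ?thesis by (simp only: \<gamma>)
  qed
qed

section \<open>The order of the families $S_\xi$\<close>

lemma S_fam_finite:
  "limit_part \<xi> = ord_zero \<Longrightarrow> \<sigma> \<in> S_fam \<zeta> \<xi> \<longleftrightarrow> \<sigma> \<in> FinN \<and> card \<sigma> \<le> finite_part \<xi>"
  by (subst S_fam.simps) simp

lemma S_fam_infinite:
  assumes "fundamental_seqs \<zeta>" "limit_part \<xi> \<noteq> ord_zero"
  shows "\<sigma> \<in> S_fam \<zeta> \<xi> \<longleftrightarrow> \<sigma> \<in> FinN \<and> (\<exists>l\<in>{1..i_part \<sigma> (finite_part \<xi>)}.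
    K_part \<sigma> (finite_part \<xi>) = {} \<or>
    K_part \<sigma> (finite_part \<xi>) \<in> S_fam \<zeta> (ord_plus (\<zeta> (limit_part \<xi>) l) l))"
  using fundamental_seqs_guard[OF assms] assms(2) by (subst S_fam.simps) auto

lemma S_fam_subset_FinN: "S_fam \<zeta> \<xi> \<subseteq> FinN"
  by (subst S_fam.simps) auto

lemma sorted_list_of_set_insert_min:
  assumes "finite \<sigma>" "\<And>x. x \<in> \<sigma> \<Longrightarrow> a < x"
  shows "sorted_list_of_set (insert a \<sigma>) = a # sorted_list_of_set (\<sigma> :: nat set)"
proof -
  have "Min (insert a \<sigma>) = a" using assms by (intro Min_eqI) (auto intro: less_imp_le)
  moreover have "insert a \<sigma> - {a} = \<sigma>" using assms(2) by auto
  ultimately show ?thesis using sorted_list_of_set_nonempty[of "insert a \<sigma>"] assms(1) by simp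
qed

text \<open>A new minimum takes position \<open>0\<close> and moves all other elements up by one
  place.\<close>

lemma K_part_insert_min:
  assumes "finite \<sigma>" "\<And>x. x \<in> \<sigma> \<Longrightarrow> a < x"
  shows "K_part (insert a \<sigma>) 0 = \<sigma>" "K_part (insert a \<sigma>) (Suc n) = K_part \<sigma> n"
  using sorted_list_of_set_insert_min[OF assms] assms(1) by (auto simp: K_part_def)

lemma i_part_insert_min:
  assumes "finite \<sigma>" "\<And>x. x \<in> \<sigma> \<Longrightarrow> a < x"
  shows "i_part (insert a \<sigma>) 0 = a" "\<sigma> \<noteq> {} \<Longrightarrow> i_part (insert a \<sigma>) (Suc n) = i_part \<sigma> n"
proof -
  have "a \<notin> \<sigma>" using assms(2) by blast
  then have card: "card (insert a \<sigma>) = Suc (card \<sigma>)" using assms(1) by simp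
  then show "i_part (insert a \<sigma>) 0 = a"
    using sorted_list_of_set_insert_min[OF assms] by (simp add: i_part_def)
  show "i_part (insert a \<sigma>) (Suc n) = i_part \<sigma> n" if "\<sigma> \<noteq> {}"
  proof -
    have "a \<le> Max \<sigma>" using that assms Max_in less_imp_le by blast
    then have "Max (insert a \<sigma>) = Max \<sigma>" using that assms(1) by simp
    then show ?thesis using card sorted_list_of_set_insert_min[OF assms] by (simp add: i_part_def)
  qed
qed

lemma singleton_in_S_fam:
  assumes "fundamental_seqs \<zeta>" "\<xi> \<noteq> ord_zero" "0 < a"
  shows "{a} \<in> S_fam \<zeta> \<xi>"
proof (cases "limit_part \<xi> = ord_zero")
  case True
  then have "finite_part \<xi> \<noteq> 0" using limit_finite_part(2)[of \<xi>] assms(2) by (metis ord_plus_0)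
  then show ?thesis using True assms(3) by (simp add: S_fam_finite FinN_def)
next
  case False
  have "i_part {a} k = a" "K_part {a} k = {}" for k by (auto simp: i_part_def K_part_def)
  then show ?thesis using assms(3) by (auto simp: S_fam_infinite[OF assms(1) False] FinN_def)
qed

text \<open>For infinite \<open>l\<close>, the tail and the index at position \<open>n\<close> of
  \<sigma> reappear at position \<open>n + 1\<close> after the insertion, so the two membership
  conditions coincide. For \<open>l = 0\<close> only the size counts.\<close>

lemma insert_min_in_S_fam_Suc:
  assumes "fundamental_seqs \<zeta>" "l = ord_zero \<or> limit_ord l" "\<sigma> \<in> S_fam \<zeta> (ord_plus l n)"
    and "0 < a" "\<And>x. x \<in> \<sigma> \<Longrightarrow> a < x"
  shows "insert a \<sigma> \<in> S_fam \<zeta> (ord_plus l (Suc n))"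
proof -
  note lp = limit_part_unique[OF assms(2)]
  have \<sigma>: "\<sigma> \<in> FinN" using assms(3) S_fam_subset_FinN by blast
  then have ins: "insert a \<sigma> \<in> FinN" and fin: "finite \<sigma>" "\<sigma> \<noteq> {}" using assms(4) by (auto simp: FinN_def)
  show ?thesis
  proof (cases "l = ord_zero")
    case True
    have "card (insert a \<sigma>) \<le> Suc (card \<sigma>)" using card_insert_le_m1[of _ \<sigma> a] fin by (simp add: card_insert_if)
    then show ?thesis using assms(3) True lp[of n] lp[of "Suc n"] ins by (simp add: S_fam_finite del: ord_plus_Suc)
  next
    case False
    then show ?thesis
      using assms(3) lp[of n] lp[of "Suc n"] ins K_part_insert_min(2)[OF fin(1) assms(5)]
        i_part_insert_min(2)[OF fin(1) assms(5) fin(2)]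
      by (simp add: S_fam_infinite[OF assms(1)] del: ord_plus_Suc)
  qed
qed

text \<open>At finite part \<open>0\<close> the tail is all of \<sigma> and the index is the new
  minimum \<open>a\<close>, whence the condition l \<le> a.\<close>

lemma insert_min_in_S_fam_limit:
  assumes "fundamental_seqs \<zeta>" "limit_ord \<xi>" "\<sigma> \<in> S_fam \<zeta> (ord_plus (\<zeta> \<xi> l) l)"
    and "1 \<le> l" "l \<le> a" "\<And>x. x \<in> \<sigma> \<Longrightarrow> a < x"
  shows "insert a \<sigma> \<in> S_fam \<zeta> \<xi>"
proof -
  have lp: "limit_part \<xi> = \<xi>" "finite_part \<xi> = 0" using limit_part_unique[of \<xi> 0] assms(2) by auto
  have \<sigma>: "\<sigma> \<in> FinN" using assms(3) S_fam_subset_FinN by blast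
  then have "insert a \<sigma> \<in> FinN" "finite \<sigma>" using assms(4,5) by (auto simp: FinN_def)
  moreover have "limit_part \<xi> \<noteq> ord_zero" using lp assms(2) by (simp add: limit_ord_def)
  ultimately show ?thesis
    using assms(3-5) lp K_part_insert_min(1)[OF _ assms(6)] i_part_insert_min(1)[OF _ assms(6)]
    by (auto simp: S_fam_infinite[OF assms(1)])
qed

text \<open>Only the members of the family beyond a threshold \<open>N\<close> are required to have
  their image in \<open>M\<close>; this weak hypothesis survives links. Linking \<open>M\<close> at
  the image of some \<open>a > N\<close> leaves all images of members beyond \<open>a\<close> of an
  earlier family, to which the induction hypothesis applies with threshold \<open>a\<close>.\<close>

theorem Ord_le_S_fam_image:
  fixes \<phi> :: "nat \<Rightarrow> nat"
  assumes \<zeta>: "fundamental_seqs \<zeta>" and \<phi>: "inj \<phi>" "\<And>k. 0 < \<phi> k"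
    and "\<And>\<sigma>. \<sigma> \<in> S_fam \<zeta> \<xi> \<Longrightarrow> (\<forall>x\<in>\<sigma>. N < x) \<Longrightarrow> \<phi> ` \<sigma> \<in> M"
    and "Ord_le M \<beta>"
  shows "\<xi> \<le> \<beta>"
  using assms(4,5)
proof (induction \<xi> arbitrary: N M \<beta> rule: less_induct)
  case (less \<xi>)
  show ?case
  proof (cases "\<xi> = ord_zero")
    case False
    have "\<phi> ` {Suc N} \<in> M" using singleton_in_S_fam[OF \<zeta> False] by (intro less.prems) auto
    then have \<beta>0: "\<beta> \<noteq> ord_zero" using less.prems(2) by (auto simp: Ord_le_zero)
    \<comment> \<open>One link: the bound for \<open>M\<close> strictly exceeds a bound for its link
      at \<open>\<phi> a\<close>, which is at least \<xi>' by induction.\<close>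
    have step: "\<xi>' < \<beta>"
      if "\<xi>' < \<xi>" "N < a" "\<And>\<sigma>. \<sigma> \<in> S_fam \<zeta> \<xi>' \<Longrightarrow> (\<forall>x\<in>\<sigma>. a < x) \<Longrightarrow> insert a \<sigma> \<in> S_fam \<zeta> \<xi>"
      for \<xi>' a
    proof -
      have "1 \<le> \<phi> a" using \<phi>(2)[of a] by simp
      then obtain \<beta>' where \<beta>': "\<beta>' < \<beta>" "Ord_le (link_at M (\<phi> a)) \<beta>'"
        using less.prems(2) unfolding Ord_le_pos[OF \<beta>0] by blast
      have "\<xi>' \<le> \<beta>'"
      proof (rule less.IH[OF that(1) _ \<beta>'(2)])
        fix \<sigma> assume \<sigma>: "\<sigma> \<in> S_fam \<zeta> \<xi>'" "\<forall>x\<in>\<sigma>. a < x"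
        have "\<phi> ` insert a \<sigma> \<in> M"
          using that(2) \<sigma> by (intro less.prems(1) that(3)) auto
        moreover have "\<phi> ` \<sigma> \<in> FinN"
          using subsetD[OF S_fam_subset_FinN \<sigma>(1)] by (auto simp: FinN_def image_iff less_imp_neq[OF \<phi>(2)])
        moreover have "\<phi> a \<notin> \<phi> ` \<sigma>" using \<sigma>(2) \<phi>(1) by (auto dest: injD)
        ultimately show "\<phi> ` \<sigma> \<in> link_at M (\<phi> a)" by (simp add: link_at_def)
      qed
      then show ?thesis using \<beta>'(1) by simp
    qed
    define l n where "l = limit_part \<xi>" and "n = finite_part \<xi>"
    have \<xi>: "ord_plus l n = \<xi>" and l: "l = ord_zero \<or> limit_ord l"
      unfolding l_def n_def by (rule limit_finite_part)+
    show ?thesis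
    proof (cases n)
      case (Suc k)
      have "ord_plus l k < \<beta>"
      proof (rule step[of _ "Suc N"])
        show "ord_plus l k < \<xi>" using \<xi> Suc ord_succ_greater[of "ord_plus l k"] by simp
        show "insert (Suc N) \<sigma> \<in> S_fam \<zeta> \<xi>"
          if "\<sigma> \<in> S_fam \<zeta> (ord_plus l k)" "\<forall>x\<in>\<sigma>. Suc N < x" for \<sigma>
          using insert_min_in_S_fam_Suc[OF \<zeta> l that(1)] that(2) \<xi> Suc by auto
      qed simp
      then show ?thesis using \<xi> Suc by (auto simp: ord_succ_le_iff)
    next
      case 0
      then have lim: "limit_ord \<xi>" using \<xi> l False by auto
      show ?thesis
      proof (rule ccontr)
        assume "\<not> \<xi> \<le> \<beta>"
        have lub: "isLub UNIV ((\<lambda>i. ord_plus (\<zeta> \<xi> i) i) ` {1..}) \<xi>"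
          using \<zeta> lim by (simp add: fundamental_seqs_def)
        have "\<exists>i\<ge>1. \<beta> < ord_plus (\<zeta> \<xi> i) i"
        proof (rule ccontr)
          assume "\<not> ?thesis"
          then have "isUb UNIV ((\<lambda>i. ord_plus (\<zeta> \<xi> i) i) ` {1..}) \<beta>"
            by (auto simp: isUb_def setle_def not_less)
          then show False using isLub_le_isUb[OF lub] \<open>\<not> \<xi> \<le> \<beta>\<close> by blast
        qed
        then obtain i where i: "1 \<le> i" "\<beta> < ord_plus (\<zeta> \<xi> i) i" by blast
        have "limit_part \<xi> = \<xi>" using limit_part_unique(1)[of \<xi> 0] lim by simp
        then have less: "ord_plus (\<zeta> \<xi> i) i < \<xi>"
          using fundamental_seqs_guard[OF \<zeta>, of \<xi> i] False i(1) by simp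
        have "ord_plus (\<zeta> \<xi> i) i < \<beta>"
          \<comment> \<open>\<open>Suc (N + i)\<close> exceeds the threshold \<open>N\<close> and
            also \<open>i\<close>, so that the \<open>i\<close>-th term of the fundamental sequence
            is an admissible choice.\<close>
          using insert_min_in_S_fam_limit[OF \<zeta> lim _ i(1)] by (intro step[OF less, of "Suc (N + i)"]) auto
        then show False using i(2) by simp
      qed
    qed
  qed (simp add: ord_zero_le)
qed

section \<open>Separators in nested grids\<close>

definition grid_floor :: "int \<Rightarrow> int \<Rightarrow> int"
  where "grid_floor g t = g * (t div g)"

definition grid_ceil :: "int \<Rightarrow> int \<Rightarrow> int"
  where "grid_ceil g t = - grid_floor g (- t)"

text \<open>For positive \<open>g\<close>, the smallest closed face containing \<open>y\<close> of
  the grid of mesh \<open>g\<close> in the first \<open>n\<close> coordinates; the other coordinates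
  are free. Its dimension is the size of \<open>off_grid n g y\<close>.\<close>

definition grid_cell :: "nat \<Rightarrow> int \<Rightarrow> (nat \<Rightarrow> int) \<Rightarrow> (nat \<Rightarrow> int) set"
  where "grid_cell n g y = {x. \<forall>i<n. grid_floor g (y i) \<le> x i \<and> x i \<le> grid_ceil g (y i)}"

definition off_grid :: "nat \<Rightarrow> int \<Rightarrow> (nat \<Rightarrow> int) \<Rightarrow> nat set"
  where "off_grid n g x = {i. i < n \<and> \<not> g dvd x i}"

lemma finite_off_grid [simp]: "finite (off_grid n g x)"
  by (simp add: off_grid_def)

lemma multiple_le_multiple:
  fixes a b g :: int
  assumes "g dvd a" "g dvd b" "a < b + g"
  shows "a \<le> b"
proof (rule ccontr)
  assume "\<not> a \<le> b"
  moreover have "g dvd a - b" using assms by simp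
  ultimately have "g \<le> a - b" by (intro zdvd_imp_le) auto
  then show False using assms(3) by simp
qed

lemma dvd_grid_floor [simp]: "g dvd grid_floor g t"
  and dvd_grid_ceil [simp]: "g dvd grid_ceil g t"
  by (simp_all add: grid_floor_def grid_ceil_def)

lemma grid_floor_le: "0 < g \<Longrightarrow> grid_floor g t \<le> t"
  and less_grid_floor: "0 < g \<Longrightarrow> t < grid_floor g t + g"
proof -
  assume "0 < g"
  then have "0 \<le> t mod g" "t mod g < g" by simp_all
  then show "grid_floor g t \<le> t" "t < grid_floor g t + g"
    using mult_div_mod_eq[of g t] unfolding grid_floor_def by linarith+
qed

lemma le_grid_ceil: "0 < g \<Longrightarrow> t \<le> grid_ceil g t"
  and grid_ceil_less: "0 < g \<Longrightarrow> grid_ceil g t < t + g"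
  using grid_floor_le[of g "- t"] less_grid_floor[of g "- t"] by (simp_all add: grid_ceil_def)

lemma grid_floor_greatest: "0 < g \<Longrightarrow> g dvd a \<Longrightarrow> a \<le> t \<Longrightarrow> a \<le> grid_floor g t"
  using less_grid_floor[of g t] by (intro multiple_le_multiple[of g]) auto

lemma grid_ceil_least: "0 < g \<Longrightarrow> g dvd a \<Longrightarrow> t \<le> a \<Longrightarrow> grid_ceil g t \<le> a"
  using grid_ceil_less[of g t] by (intro multiple_le_multiple[of g]) auto

lemma grid_ceil_le_floor: "0 < g \<Longrightarrow> grid_ceil g t \<le> grid_floor g t + g"
  using less_grid_floor[of g t] by (intro grid_ceil_least) auto

lemma grid_floor_dvd: "0 < g \<Longrightarrow> g dvd t \<Longrightarrow> grid_floor g t = t"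
  and grid_ceil_dvd: "0 < g \<Longrightarrow> g dvd t \<Longrightarrow> grid_ceil g t = t"
  by (simp_all add: grid_floor_def grid_ceil_def)

lemma mem_grid_cell: "0 < g \<Longrightarrow> x \<in> grid_cell n g x"
  by (simp add: grid_cell_def grid_floor_le le_grid_ceil)

lemma grid_cell_diam:
  assumes "0 < g" "x \<in> grid_cell n g w" "y \<in> grid_cell n g w" "i < n"
  shows "\<bar>x i - y i\<bar> \<le> g"
  using assms(2-4) grid_ceil_le_floor[OF assms(1), of "w i"]
  unfolding grid_cell_def by (fastforce simp: abs_le_iff)

text \<open>In a coordinate where \<open>y\<close> is a multiple of \<open>g\<close> the face has no
  extent, so \<open>x\<close> agrees with \<open>y\<close> there.\<close>

lemma off_grid_subset:
  assumes "0 < g" "x \<in> grid_cell n g y"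
  shows "off_grid n g x \<subseteq> off_grid n g y"
  using assms(2) grid_floor_dvd[OF assms(1)] grid_ceil_dvd[OF assms(1)]
  unfolding off_grid_def grid_cell_def by clarsimp (metis order_antisym)

lemma off_grid_mono: "g dvd h \<Longrightarrow> off_grid n g x \<subseteq> off_grid n h x"
  unfolding off_grid_def using dvd_trans by blast

lemma grid_cell_mono:
  assumes "0 < g" "x \<in> grid_cell n g y"
  shows "grid_cell n g x \<subseteq> grid_cell n g y"
proof
  fix z assume z: "z \<in> grid_cell n g x"
  have "grid_floor g (y i) \<le> z i \<and> z i \<le> grid_ceil g (y i)" if "i < n" for i
  proof -
    have "grid_floor g (y i) \<le> grid_floor g (x i)" "grid_ceil g (x i) \<le> grid_ceil g (y i)"
      using assms that by (auto simp: grid_cell_def intro!: grid_floor_greatest grid_ceil_least)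
    then show ?thesis using z that by (force simp: grid_cell_def)
  qed
  then show "z \<in> grid_cell n g y" by (simp add: grid_cell_def)
qed

text \<open>Multiples of \<open>h\<close> are multiples of \<open>g\<close>, so the ends of the
  coarse interval enclose those of the fine one.\<close>

lemma grid_cell_refine:
  assumes "0 < g" "0 < h" "g dvd h"
  shows "grid_cell n g x \<subseteq> grid_cell n h x"
proof
  fix z assume z: "z \<in> grid_cell n g x"
  have "grid_floor h (x i) \<le> z i \<and> z i \<le> grid_ceil h (x i)" if "i < n" for i
  proof -
    have "grid_floor h (x i) \<le> grid_floor g (x i)" "grid_ceil g (x i) \<le> grid_ceil h (x i)"
      using assms grid_floor_le[of h "x i"] le_grid_ceil[of h "x i"]
      by (auto intro!: grid_floor_greatest grid_ceil_least
          intro: dvd_trans[OF assms(3) dvd_grid_floor] dvd_trans[OF assms(3) dvd_grid_ceil])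
    then show ?thesis using z that by (force simp: grid_cell_def)
  qed
  then show "z \<in> grid_cell n h x" by (simp add: grid_cell_def)
qed

text \<open>If no free direction is lost, \<open>x\<close> lies in the relative interior of the face
  of \<open>y\<close>: in each free direction it is strictly between the same consecutive multiples
  of \<open>g\<close>.\<close>

lemma grid_cell_eq:
  assumes g: "0 < g" and x: "x \<in> grid_cell n g y" and off: "off_grid n g x = off_grid n g y"
  shows "grid_cell n g x = grid_cell n g y"
proof -
  have "y \<in> grid_cell n g x"
    unfolding grid_cell_def
  proof (intro CollectI allI impI)
    fix i assume i: "i < n"
    have xi: "grid_floor g (y i) \<le> x i" "x i \<le> grid_ceil g (y i)"
      using x i by (auto simp: grid_cell_def)
    show "grid_floor g (x i) \<le> y i \<and> y i \<le> grid_ceil g (x i)"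
    proof (cases "g dvd y i")
      case True
      then have "x i = y i" using xi grid_floor_dvd[OF g True] grid_ceil_dvd[OF g True] by simp
      then show ?thesis using grid_floor_le[OF g] le_grid_ceil[OF g] by simp
    next
      case False
      then have nd: "\<not> g dvd x i" using off i by (auto simp: off_grid_def)
      then have "x i \<noteq> grid_ceil g (y i)" "x i \<noteq> grid_floor g (y i)"
        by (metis dvd_grid_ceil, metis dvd_grid_floor)
      then have "x i < grid_ceil g (y i)" "grid_floor g (y i) < x i" using xi by auto
      then have "grid_floor g (x i) \<le> grid_floor g (y i)" "grid_ceil g (y i) \<le> grid_ceil g (x i)"
        using grid_ceil_le_floor[OF g, of "y i"] grid_floor_le[OF g, of "x i"]
          le_grid_ceil[OF g, of "x i"]
        by (auto intro!: multiple_le_multiple[of g])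
      then show ?thesis using grid_floor_le[OF g, of "y i"] le_grid_ceil[OF g, of "y i"] by linarith
    qed
  qed
  then show ?thesis using grid_cell_mono[OF g] x by blast
qed

text \<open>Interval ends are multiples of \<open>g\<close>, so two intervals with points less than
  \<open>g\<close> apart overlap. Clamping \<open>x\<close> to the second face therefore does not
  leave the first one, and moves \<open>x\<close> by at most its distance to
  \<open>y\<close>.\<close>

lemma grid_cells_meet:
  assumes g: "0 < g" and x: "x \<in> grid_cell n g w" and y: "y \<in> grid_cell n g w'"
    and near: "\<forall>i<n. \<bar>x i - y i\<bar> \<le> \<delta>" and "\<delta> < g"
  obtains z where "z \<in> grid_cell n g w" "z \<in> grid_cell n g w'" "\<forall>i<n. \<bar>x i - z i\<bar> \<le> \<delta>"
proof
  let ?z = "\<lambda>i. max (grid_floor g (w' i)) (min (grid_ceil g (w' i)) (x i))"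
  have y': "grid_floor g (w' i) \<le> y i" "y i \<le> grid_ceil g (w' i)" if "i < n" for i
    using y that by (auto simp: grid_cell_def)
  have x': "grid_floor g (w i) \<le> x i" "x i \<le> grid_ceil g (w i)" if "i < n" for i
    using x that by (auto simp: grid_cell_def)
  have n': "x i - y i \<le> \<delta>" "y i - x i \<le> \<delta>" if "i < n" for i
    using near that by (auto simp: abs_le_iff)
  show "\<forall>i<n. \<bar>x i - ?z i\<bar> \<le> \<delta>"
    using y' n' by (fastforce simp: max_def min_def abs_le_iff)
  show "?z \<in> grid_cell n g w'"
    unfolding grid_cell_def using y' by fastforce
  show "?z \<in> grid_cell n g w"
    unfolding grid_cell_def
  proof (intro CollectI allI impI)
    fix i assume i: "i < n"
    have "grid_floor g (w' i) \<le> grid_ceil g (w i)" "grid_floor g (w i) \<le> grid_ceil g (w' i)"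
      using y'[OF i] x'[OF i] n'[OF i] \<open>\<delta> < g\<close> by (auto intro!: multiple_le_multiple[of g])
    then show "grid_floor g (w i) \<le> ?z i \<and> ?z i \<le> grid_ceil g (w i)"
      using x'[OF i] by auto
  qed
qed

definition near :: "nat \<Rightarrow> (nat \<Rightarrow> int) set \<Rightarrow> int \<Rightarrow> (nat \<Rightarrow> int) \<Rightarrow> bool"
  where "near n S e x \<longleftrightarrow> (\<exists>y\<in>S. \<forall>i<n. \<bar>x i - y i\<bar> \<le> e)"

lemma near_trans:
  assumes "near n S e x" "\<forall>i<n. \<bar>x i - y i\<bar> \<le> d"
  shows "near n S (e + d) y"
proof -
  obtain z where z: "z \<in> S" "\<forall>i<n. \<bar>x i - z i\<bar> \<le> e" using assms(1) by (auto simp: near_def)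
  have "\<bar>y i - z i\<bar> \<le> e + d" if "i < n" for i
  proof -
    have "\<bar>x i - z i\<bar> \<le> e" "\<bar>x i - y i\<bar> \<le> d" using z(2) assms(2) that by auto
    then show ?thesis by linarith
  qed
  then show ?thesis using z(1) by (auto simp: near_def)
qed

lemma near_mono: "near n S e x \<Longrightarrow> e \<le> e' \<Longrightarrow> near n S e' x"
  unfolding near_def by (meson order_trans)

section \<open>Splitting a union of faces along one family\<close>

locale multigrid_families =
  fixes n :: nat and g :: "nat \<Rightarrow> int" and W :: "nat \<Rightarrow> (nat \<Rightarrow> int) set set" and R :: int
  assumes g_pos: "j < n \<Longrightarrow> 0 < g j"
    and g_dvd: "i \<le> j \<Longrightarrow> j < n \<Longrightarrow> g i dvd g j"
    and W_bounded: "j < n \<Longrightarrow> U \<in> W j \<Longrightarrow> x \<in> U \<Longrightarrow> y \<in> U \<Longrightarrow> i < n \<Longrightarrow> \<bar>x i - y i\<bar> \<le> R"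
    and W_disjoint: "j < n \<Longrightarrow> U \<in> W j \<Longrightarrow> V \<in> W j \<Longrightarrow> U \<noteq> V \<Longrightarrow> x \<in> U \<Longrightarrow> y \<in> V \<Longrightarrow>
      \<exists>i<n. g j < \<bar>x i - y i\<bar>"
begin

text \<open>By \<open>W_disjoint\<close> a cell of mesh \<open>g j\<close> meets at most one member
  of \<open>W j\<close>. Such a cell is classified by that member and not by its own position, so no
  member is cut; the remaining cells are classified by position.\<close>

definition low_cell :: "nat \<Rightarrow> (nat \<Rightarrow> int) set \<Rightarrow> bool"
  where "low_cell j C \<longleftrightarrow> (\<exists>U\<in>W j. U \<inter> C \<noteq> {} \<and> (\<exists>u\<in>U. u j \<le> 0)) \<or>
    ((\<forall>U\<in>W j. U \<inter> C = {}) \<and> (\<forall>x\<in>C. x j \<le> 0))"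

definition lower_part :: "nat \<Rightarrow> (nat \<Rightarrow> int) set \<Rightarrow> (nat \<Rightarrow> int) set"
  where "lower_part j S = (\<Union>y\<in>{y\<in>S. low_cell j (grid_cell n (g j) y)}. grid_cell n (g j) y)"

definition upper_part :: "nat \<Rightarrow> (nat \<Rightarrow> int) set \<Rightarrow> (nat \<Rightarrow> int) set"
  where "upper_part j S = (\<Union>y\<in>{y\<in>S. \<not> low_cell j (grid_cell n (g j) y)}. grid_cell n (g j) y)"

lemma part_cases: "j < n \<Longrightarrow> x \<in> S \<Longrightarrow> x \<in> lower_part j S \<or> x \<in> upper_part j S"
  unfolding lower_part_def upper_part_def using mem_grid_cell[OF g_pos] by blast

lemma lower_part_le:
  assumes j: "j < n" and x: "x \<in> lower_part j S"
  shows "x j \<le> \<bar>R\<bar> + g j"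
proof -
  obtain y where y: "low_cell j (grid_cell n (g j) y)" "x \<in> grid_cell n (g j) y"
    using x by (auto simp: lower_part_def)
  from y(1) consider U u v where "U \<in> W j" "v \<in> U" "v \<in> grid_cell n (g j) y" "u \<in> U" "u j \<le> 0"
    | "\<forall>x\<in>grid_cell n (g j) y. x j \<le> 0"
    unfolding low_cell_def by blast
  then show ?thesis
  proof cases
    case 1
    then have "\<bar>v j - u j\<bar> \<le> R" "\<bar>x j - v j\<bar> \<le> g j"
      using W_bounded[OF j] grid_cell_diam[OF g_pos[OF j] y(2)] j by auto
    then show ?thesis using 1 by linarith
  next
    case 2
    then show ?thesis using y(2) g_pos[OF j] by force
  qed
qed

text \<open>A cell that is not low contains a point with positive coordinate \<open>j\<close>:
  either it meets a member that lies wholly on the positive side, or it meets none and is not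
  contained in the low half-space.\<close>

lemma upper_part_ge:
  assumes j: "j < n" and x: "x \<in> upper_part j S"
  shows "- g j \<le> x j"
proof -
  obtain y where y: "\<not> low_cell j (grid_cell n (g j) y)" "x \<in> grid_cell n (g j) y"
    using x by (auto simp: upper_part_def)
  have "\<exists>v \<in> grid_cell n (g j) y. v j > 0"
    using y(1) unfolding low_cell_def by (metis disjoint_iff not_le)
  then obtain v where "v \<in> grid_cell n (g j) y" "v j > 0" by blast
  then show ?thesis using grid_cell_diam[OF g_pos[OF j] y(2), of v j] j by linarith
qed

text \<open>If \<open>z\<close> were in \<open>U\<close>, the cell that is not low would put
  \<open>U\<close> on the positive side. The low cell, which also meets \<open>U\<close>, would then
  have to meet a second member, and distinct members are too far apart for that.\<close>

lemma separator_avoids: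
  assumes j: "j < n" and z: "z \<in> lower_part j S \<inter> upper_part j S" and U: "U \<in> W j"
  shows "z \<notin> U"
proof
  assume zU: "z \<in> U"
  obtain y where y: "low_cell j (grid_cell n (g j) y)" "z \<in> grid_cell n (g j) y"
    using z by (auto simp: lower_part_def)
  obtain y' where y': "\<not> low_cell j (grid_cell n (g j) y')" "z \<in> grid_cell n (g j) y'"
    using z by (auto simp: upper_part_def)
  have "\<not> (\<exists>u\<in>U. u j \<le> 0)" using y' U zU unfolding low_cell_def by blast
  moreover obtain V v u where V: "V \<in> W j" "v \<in> V" "v \<in> grid_cell n (g j) y" "u \<in> V" "u j \<le> 0"
    using y U zU unfolding low_cell_def by blast
  ultimately have "U \<noteq> V" by blast
  then obtain i where "i < n" "g j < \<bar>z i - v i\<bar>" using W_disjoint[OF j U V(1) _ zU V(2)] by blast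
  then show False using grid_cell_diam[OF g_pos[OF j] y(2) V(3)] by fastforce
qed

text \<open>With \<open>j + 1\<close> free directions, \<open>z\<close> would be interior to a face
  of maximal dimension in \<open>S\<close>. Only one cell then contains \<open>z\<close>, and it
  cannot be both low and not low.\<close>

lemma separator_off_grid:
  assumes j: "j < n" and z: "z \<in> lower_part j S \<inter> upper_part j S"
    and S: "\<And>y. y \<in> S \<Longrightarrow> card (off_grid n (g j) y) \<le> Suc j"
  shows "card (off_grid n (g j) z) \<le> j"
proof (rule ccontr)
  assume *: "\<not> card (off_grid n (g j) z) \<le> j"
  note pos = g_pos[OF j]
  have eq: "grid_cell n (g j) z = grid_cell n (g j) y" if "y \<in> S" "z \<in> grid_cell n (g j) y" for y
  proof (rule grid_cell_eq[OF pos that(2)])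
    show "off_grid n (g j) z = off_grid n (g j) y"
      using * S[OF that(1)] by (intro card_seteq off_grid_subset[OF pos that(2)]) simp_all
  qed
  obtain y y' where "y \<in> S" "z \<in> grid_cell n (g j) y" "low_cell j (grid_cell n (g j) y)"
    and "y' \<in> S" "z \<in> grid_cell n (g j) y'" "\<not> low_cell j (grid_cell n (g j) y')"
    using z unfolding lower_part_def upper_part_def by blast
  then show False using eq by metis
qed

lemma cell_subset_part:
  assumes "j < n"
  shows "z \<in> lower_part j S \<Longrightarrow> grid_cell n (g j) z \<subseteq> lower_part j S"
    and "z \<in> upper_part j S \<Longrightarrow> grid_cell n (g j) z \<subseteq> upper_part j S"
  unfolding lower_part_def upper_part_def using grid_cell_mono[OF g_pos[OF assms]] by fast+

text \<open>\<open>x\<close> already lies in one part; its cell and the cell of a nearby point of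
  the other part meet, and both parts are unions of cells.\<close>

lemma parts_meet:
  assumes j: "j < n" and x: "x \<in> lower_part j S \<union> upper_part j S"
    and "near n (lower_part j S) \<delta> x" "near n (upper_part j S) \<delta> x" and "\<delta> < g j"
  obtains z where "z \<in> lower_part j S \<inter> upper_part j S" "\<forall>i<n. \<bar>x i - z i\<bar> \<le> \<delta>"
proof -
  obtain a where a: "a \<in> lower_part j S" "\<forall>i<n. \<bar>x i - a i\<bar> \<le> \<delta>"
    using assms(3) by (auto simp: near_def)
  obtain b where b: "b \<in> upper_part j S" "\<forall>i<n. \<bar>x i - b i\<bar> \<le> \<delta>"
    using assms(4) by (auto simp: near_def)
  note pos = g_pos[OF j]
  from x show ?thesis
  proof
    assume x: "x \<in> lower_part j S"
    obtain z where "z \<in> grid_cell n (g j) x" "z \<in> grid_cell n (g j) b" "\<forall>i<n. \<bar>x i - z i\<bar> \<le> \<delta>"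
      using grid_cells_meet[OF pos mem_grid_cell[OF pos] mem_grid_cell[OF pos] b(2) assms(5)] .
    then show ?thesis using that cell_subset_part[OF j] x b(1) by blast
  next
    assume x: "x \<in> upper_part j S"
    obtain z where "z \<in> grid_cell n (g j) x" "z \<in> grid_cell n (g j) a" "\<forall>i<n. \<bar>x i - z i\<bar> \<le> \<delta>"
      using grid_cells_meet[OF pos mem_grid_cell[OF pos] mem_grid_cell[OF pos] a(2) assms(5)] .
    then show ?thesis using that cell_subset_part[OF j] x a(1) by blast
  qed
qed

section \<open>Nested separators, from the largest scale down\<close>

primrec separator :: "nat \<Rightarrow> (nat \<Rightarrow> int) set"
  where "separator 0 = UNIV"
  | "separator (Suc d) =
      lower_part (n - Suc d) (separator d) \<inter> upper_part (n - Suc d) (separator d)"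

lemma part_subset:
  assumes "j < n" and "\<And>y. y \<in> S \<Longrightarrow> grid_cell n (g j) y \<subseteq> S"
  shows "lower_part j S \<subseteq> S" "upper_part j S \<subseteq> S"
  using assms(2) unfolding lower_part_def upper_part_def by fast+

text \<open>The first \<open>d\<close> stages use the levels \<open>n - 1\<close> down to
  \<open>n - d\<close>. The outcome is a union of faces of the last mesh used, hence of faces of the
  next one, which divides it.\<close>

lemma separator_cell:
  "d < n \<Longrightarrow> y \<in> separator d \<Longrightarrow> grid_cell n (g (n - Suc d)) y \<subseteq> separator d"
proof (induction d)
  case (Suc d)
  have "grid_cell n (g (n - Suc (Suc d))) y \<subseteq> grid_cell n (g (n - Suc d)) y"
    using Suc.prems by (intro grid_cell_refine g_pos g_dvd) auto
  also have "\<dots> \<subseteq> separator (Suc d)"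
    using Suc.prems cell_subset_part[of "n - Suc d" y "separator d"] by simp
  finally show ?case .
qed simp

lemma separator_Suc_subset: "d < n \<Longrightarrow> separator (Suc d) \<subseteq> separator d"
  using part_subset[of "n - Suc d" "separator d"] separator_cell by auto

lemma separator_antimono: "d \<le> d' \<Longrightarrow> d' \<le> n \<Longrightarrow> separator d' \<subseteq> separator d"
proof (induction d' rule: dec_induct)
  case (step k)
  then show ?case using separator_Suc_subset[of k] by simp
qed simp

text \<open>Each stage removes one dimension, and passing to a finer mesh can only turn coordinates
  into grid coordinates.\<close>

lemma separator_card:
  "d < n \<Longrightarrow> z \<in> separator (Suc d) \<Longrightarrow> card (off_grid n (g (n - Suc d)) z) \<le> n - Suc d"
proof (induction d arbitrary: z)
  case 0
  have "card (off_grid n (g (n - 1)) y) \<le> n" for y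
    using card_mono[of "{..<n}" "off_grid n (g (n - 1)) y"] by (auto simp: off_grid_def)
  then show ?case using 0 by (intro separator_off_grid[of _ _ UNIV]) auto
next
  case (Suc d)
  show ?case
  proof (rule separator_off_grid)
    show "z \<in> lower_part (n - Suc (Suc d)) (separator (Suc d)) \<inter>
        upper_part (n - Suc (Suc d)) (separator (Suc d))"
      using Suc.prems by simp
    fix y assume "y \<in> separator (Suc d)"
    then have "card (off_grid n (g (n - Suc d)) y) \<le> n - Suc d" using Suc by simp
    moreover have "card (off_grid n (g (n - Suc (Suc d))) y) \<le> card (off_grid n (g (n - Suc d)) y)"
      using Suc.prems by (intro card_mono off_grid_mono g_dvd) auto
    ultimately show "card (off_grid n (g (n - Suc (Suc d))) y) \<le> Suc (n - Suc (Suc d))"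
      using Suc.prems by simp
  qed (use Suc.prems in simp)
qed

text \<open>The label of \<open>r\<close> in direction \<open>j\<close> tells whether the lower or the upper part is closer, so that
  near a Kuhn cell, where both labels occur, each separator has points close to the previous one.\<close>

lemma separator_nonempty:
  assumes g_large: "\<And>j. j < n \<Longrightarrow> 3 ^ n \<le> g j"
  shows "separator n \<noteq> {}"
proof (cases "n = 0")
  case False
  \<comment> \<open>Summing over all levels gives one bound beyond the reach of the lower part from
    above and of the upper part from below, at every level.\<close>
  define N where "N = (\<Sum>j<n. \<bar>R\<bar> + 2 * g j + 1)"
  have N_gt: "\<bar>R\<bar> + 2 * g j < N" if "j < n" for j
  proof -
    have "\<bar>R\<bar> + 2 * g j + 1 \<le> N"
      unfolding N_def
    proof (rule member_le_sum[of j "{..<n}" "\<lambda>j. \<bar>R\<bar> + 2 * g j + 1"])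
      show "0 \<le> \<bar>R\<bar> + 2 * g i + 1" if "i \<in> {..<n} - {j}" for i using g_pos[of i] that by simp
    qed (use that in simp_all)
    then show ?thesis by simp
  qed
  have N_pos: "0 < N" using N_gt[of 0] g_pos[of 0] False by linarith
  \<comment> \<open>Moves Kuhn's cube with side \<open>2 * N\<close> so that it is centred at the
    origin.\<close>
  define c where "c r = (\<lambda>i. int (r i) - N)" for r :: "nat \<Rightarrow> nat"
  \<comment> \<open>The added half-spaces force the labels on the faces of the cube that Kuhn's
    lemma prescribes.\<close>
  define A where "A j = lower_part j (separator (n - Suc j)) \<union> {x. x j \<le> - N}" for j
  define B where "B j = upper_part j (separator (n - Suc j)) \<union> {x. N \<le> x j}" for j
  \<comment> \<open>Quantifying over \<open>e\<close> compares the distances to the two sets without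
    forming infima; a tie gets label \<open>0\<close>.\<close>
  define label where "label r j =
    (if \<forall>e. near n (B j) e (c r) \<longrightarrow> near n (A j) e (c r) then 0 else 1 :: nat)" for r j
  have zero: "label r j = 0" if "j < n" "r j = 0" for r j
  proof -
    have "c r \<in> A j" using that by (simp add: A_def c_def)
    moreover have "0 \<le> e" if "near n (B j) e (c r)" for e
      using that \<open>j < n\<close> unfolding near_def by (meson abs_ge_zero order_trans)
    ultimately have "near n (A j) e (c r)" if "near n (B j) e (c r)" for e
      using that unfolding near_def by (intro bexI[of _ "c r"]) simp_all
    then show ?thesis by (simp add: label_def)
  qed
  have one: "label r j = 1" if jr: "j < n" "r j = nat (2 * N)" for r j
  proof -
    have cj: "c r j = N" using jr N_pos by (simp add: c_def)
    then have "near n (B j) 0 (c r)" by (auto simp: near_def B_def)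
    moreover have "\<not> near n (A j) 0 (c r)"
    proof
      assume "near n (A j) 0 (c r)"
      then obtain y where "y \<in> A j" "c r j = y j" using jr(1) by (auto simp: near_def)
      then show False
        using cj N_gt[OF jr(1)] N_pos g_pos[OF jr(1)] lower_part_le[OF jr(1), of y]
        by (fastforce simp: A_def)
    qed
    ultimately show ?thesis by (auto simp: label_def)
  qed
  obtain q where q: "\<forall>i<n. q i < nat (2 * N)"
    and q_cell: "\<forall>i<n. \<exists>r s. (\<forall>j<n. q j \<le> r j \<and> r j \<le> q j + 1) \<and>
      (\<forall>j<n. q j \<le> s j \<and> s j \<le> q j + 1) \<and> label r i \<noteq> label s i"
  proof (rule kuhn_lemma[of "nat (2 * N)" n label])
    show "0 < nat (2 * N)" using N_pos by simp
    show "\<forall>x. (\<forall>i<n. x i \<le> nat (2 * N)) \<longrightarrow> (\<forall>i<n. label x i = 0 \<or> label x i = 1)"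
      by (simp add: label_def)
    show "\<forall>x. (\<forall>i<n. x i \<le> nat (2 * N)) \<longrightarrow> (\<forall>i<n. x i = 0 \<longrightarrow> label x i = 0)"
      using zero by simp
    show "\<forall>x. (\<forall>i<n. x i \<le> nat (2 * N)) \<longrightarrow> (\<forall>i<n. x i = nat (2 * N) \<longrightarrow> label x i = 1)"
      using one by simp
  qed
  \<comment> \<open>Corners of the Kuhn cell are within \<open>e + 1\<close> of \<open>x\<close>. If
    \<open>x\<close> is in the lower part, a corner with label \<open>1\<close> is within
    \<open>e + 1\<close> of \<open>A j\<close>, hence of \<open>B j\<close>, so \<open>x\<close> is
    within \<open>2 * e + 2\<close> of the upper part; the other case is symmetric. Moving
    \<open>x\<close> to the intersection of the parts adds \<open>2 * e + 2\<close> to the error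
    \<open>e\<close>.\<close>
  have step: "\<exists>z\<in>separator (Suc d). \<forall>i<n. \<bar>z i - c q i\<bar> \<le> 3 * e + 2"
    if d: "d < n" and x: "x \<in> separator d" "\<forall>i<n. \<bar>x i - c q i\<bar> \<le> e"
      and e: "2 * e + 2 < g (n - Suc d)" for d x e
  proof -
    define j where "j = n - Suc d"
    have j: "j < n" "n - Suc j = d" using d by (auto simp: j_def)
    obtain r s where rs: "\<forall>i<n. q i \<le> r i \<and> r i \<le> q i + 1" "\<forall>i<n. q i \<le> s i \<and> s i \<le> q i + 1"
      and "label r j = 0" "label s j = 1"
    proof -
      obtain r s where *: "\<forall>i<n. q i \<le> r i \<and> r i \<le> q i + 1" "\<forall>i<n. q i \<le> s i \<and> s i \<le> q i + 1"
        "label r j \<noteq> label s j" using q_cell j(1) by blast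
      then have "label r j = 0 \<and> label s j = 1 \<or> label s j = 0 \<and> label r j = 1"
        by (auto simp: label_def split: if_splits)
      then show ?thesis using that[of r s] that[of s r] * by blast
    qed
    then have r0: "near n (A j) t (c r)" if "near n (B j) t (c r)" for t
      using that by (auto simp: label_def split: if_splits)
    obtain t where t: "near n (B j) t (c s)" "\<not> near n (A j) t (c s)"
      using \<open>label s j = 1\<close> by (auto simp: label_def split: if_splits)
    have near_x: "\<forall>i<n. \<bar>x i - c u i\<bar> \<le> e + 1" "\<forall>i<n. \<bar>c u i - x i\<bar> \<le> e + 1"
      if "\<forall>i<n. q i \<le> u i \<and> u i \<le> q i + 1" for u
    proof -
      have "\<bar>x i - c u i\<bar> \<le> e + 1" if "i < n" for i
      proof -
        have "\<bar>c q i - c u i\<bar> \<le> 1"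
          using \<open>\<forall>i<n. q i \<le> u i \<and> u i \<le> q i + 1\<close> that by (force simp: c_def)
        moreover have "\<bar>x i - c q i\<bar> \<le> e" using x(2) that by blast
        ultimately show ?thesis by linarith
      qed
      then show "\<forall>i<n. \<bar>x i - c u i\<bar> \<le> e + 1" "\<forall>i<n. \<bar>c u i - x i\<bar> \<le> e + 1"
        by (simp_all add: abs_minus_commute)
    qed
    have "\<bar>x j - c q j\<bar> \<le> e" using x(2) j(1) by blast
    then have e0: "0 \<le> e" by linarith
    have self: "near n T 0 x" if "x \<in> T" for T using that by (auto simp: near_def)
    have AB: "x \<in> lower_part j (separator d) \<union> upper_part j (separator d)"
      using part_cases[OF j(1) x(1)] by blast
    \<comment> \<open>The nearby point of \<open>A j\<close> or \<open>B j\<close> cannot come from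
      an added half-space: \<open>N\<close> keeps these more than \<open>g j\<close> away from
      \<open>x\<close>.\<close>
    have far: False if "y j \<le> - N \<and> - g j \<le> x j \<or> N \<le> y j \<and> x j \<le> \<bar>R\<bar> + g j"
      and "\<forall>i<n. \<bar>x i - y i\<bar> \<le> 2 * e + 2" for y
    proof -
      have "\<bar>x j - y j\<bar> \<le> 2 * e + 2" using that(2) j(1) by blast
      then have "\<bar>x j - y j\<bar> < g j" using e unfolding j_def by linarith
      then show False using that(1) N_gt[OF j(1)] g_pos[OF j(1)] by linarith
    qed
    have nears: "near n (lower_part j (separator d)) (2 * e + 2) x \<and>
        near n (upper_part j (separator d)) (2 * e + 2) x"
    proof (cases "x \<in> lower_part j (separator d)")
      case True
      then have "x \<in> A j" by (simp add: A_def j)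
      then have "near n (A j) (e + 1) (c s)"
        using near_trans[OF self near_x(1)[OF rs(2)]] by simp
      then have "t < e + 1" using t(2) near_mono[of n "A j" "e + 1" "c s" t] by (cases "t < e + 1") auto
      then have "near n (B j) (e + 1) (c s)" using near_mono[OF t(1)] by simp
      from near_trans[OF this near_x(2)[OF rs(2)]] have "near n (B j) (2 * e + 2) x" by simp
      then obtain y where y: "y \<in> B j" "\<forall>i<n. \<bar>x i - y i\<bar> \<le> 2 * e + 2"
        by (auto simp: near_def)
      then have "y \<in> upper_part j (separator d)"
        using far[OF _ y(2)] lower_part_le[OF j(1) True] by (auto simp: B_def j(2))
      then have "near n (upper_part j (separator d)) (2 * e + 2) x"
        using y(2) unfolding near_def by (intro bexI[of _ y])
      then show ?thesis using near_mono[OF self[OF True]] e0 by simp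
    next
      case False
      then have x_up: "x \<in> upper_part j (separator d)" using AB by simp
      then have "x \<in> B j" by (simp add: B_def j)
      then have "near n (A j) (e + 1) (c r)"
        using near_trans[OF self near_x(1)[OF rs(1)]] r0 by simp
      from near_trans[OF this near_x(2)[OF rs(1)]] have "near n (A j) (2 * e + 2) x" by simp
      then obtain y where y: "y \<in> A j" "\<forall>i<n. \<bar>x i - y i\<bar> \<le> 2 * e + 2"
        by (auto simp: near_def)
      then have "y \<in> lower_part j (separator d)"
        using far[OF _ y(2)] upper_part_ge[OF j(1) x_up] by (auto simp: A_def j(2))
      then have "near n (lower_part j (separator d)) (2 * e + 2) x"
        using y(2) unfolding near_def by (intro bexI[of _ y])
      then show ?thesis using near_mono[OF self[OF x_up]] e0 by simp
    qed
    obtain z where z: "z \<in> lower_part j (separator d) \<inter> upper_part j (separator d)"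
      "\<forall>i<n. \<bar>x i - z i\<bar> \<le> 2 * e + 2"
      using parts_meet[OF j(1) AB conjunct1[OF nears] conjunct2[OF nears] e[folded j_def]] .
    have "\<bar>z i - c q i\<bar> \<le> 3 * e + 2" if "i < n" for i
    proof -
      have "\<bar>x i - z i\<bar> \<le> 2 * e + 2" "\<bar>x i - c q i\<bar> \<le> e" using x(2) z(2) that by auto
      then show ?thesis by linarith
    qed
    then show ?thesis using z(1) by (auto simp: j_def)
  qed
  \<comment> \<open>The recursion from \<open>e\<close> to \<open>3 * e + 2\<close> starting at
    \<open>0\<close> yields \<open>3 ^ d - 1\<close>; the lower bound \<open>3 ^ n\<close> on the
    meshes keeps every stage admissible.\<close>
  have "\<exists>x\<in>separator d. \<forall>i<n. \<bar>x i - c q i\<bar> \<le> 3 ^ d - 1" if "d \<le> n" for d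
    using that
  proof (induction d)
    case 0
    show ?case by (intro bexI[of _ "c q"]) simp_all
  next
    case (Suc d)
    then obtain x where x: "x \<in> separator d" "\<forall>i<n. \<bar>x i - c q i\<bar> \<le> 3 ^ d - 1" by auto
    have "(3::int) ^ Suc d \<le> 3 ^ n" using Suc.prems by (intro power_increasing) auto
    also have "\<dots> \<le> g (n - Suc d)" using Suc.prems by (intro g_large) auto
    finally have "3 * 3 ^ d \<le> g (n - Suc d)" by simp
    moreover have "(0::int) < 3 ^ d" by simp
    moreover have "2 * (t - 1) + 2 < G" if "3 * t \<le> G" "0 < t" for t G :: int
      using that by presburger
    ultimately have "2 * (3 ^ d - 1) + 2 < g (n - Suc d)" by blast
    from step[OF _ x this] Suc.prems show ?case by (simp add: algebra_simps)
  qed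
  from this[OF order_refl] obtain x where "x \<in> separator n" by (rule bexE)
  then show ?thesis by blast
next
  case True
  have "k = 0 \<Longrightarrow> separator k \<noteq> {}" for k by simp
  from this[OF True] show ?thesis .
qed

theorem uncovered_point:
  assumes "\<And>j. j < n \<Longrightarrow> 3 ^ n \<le> g j"
  shows "\<exists>z. (\<forall>p<n. card (off_grid n (g p) z) \<le> p) \<and> (\<forall>p<n. \<forall>U\<in>W p. z \<notin> U)"
proof -
  obtain z where z: "z \<in> separator n" using separator_nonempty[OF assms] by auto
  \<comment> \<open>Level \<open>p\<close> is used in passing from
    \<open>separator (n - Suc p)\<close> to its successor.\<close>
  have "z \<in> separator (Suc (n - Suc p))" if "p < n" for p
  proof -
    have "Suc (n - Suc p) \<le> n" using that by arith
    then show ?thesis using z separator_antimono[of "Suc (n - Suc p)" n] by blast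
  qed
  then have in_sep: "z \<in> separator (Suc (n - Suc p))" "n - Suc (n - Suc p) = p" if "p < n" for p
    using that by auto
  show ?thesis
  proof (intro exI[of _ z] conjI allI impI ballI)
    show "card (off_grid n (g p) z) \<le> p" if "p < n" for p
      using separator_card[of "n - Suc p" z] in_sep[OF that] that by simp
    show "z \<notin> U" if "p < n" "U \<in> W p" for p U
      using separator_avoids[of p z "separator (n - Suc p)" U] in_sep[OF that(1)] that by simp
  qed
qed

end

section \<open>The lower bound\<close>

lemma k_list_shift:
  assumes "finite \<sigma>"
  shows "k_list ((\<lambda>k. k + 2) ` \<sigma>) = sorted_list_of_set \<sigma>"
proof -
  have "sorted_list_of_set ((\<lambda>k. k + 2) ` \<sigma>) = map (\<lambda>k. k + 2) (sorted_list_of_set \<sigma>)"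
    using assms by (intro sorted_distinct_set_unique) (auto simp: sorted_map distinct_map inj_on_def)
  then show ?thesis by (simp add: k_list_def o_def)
qed

lemma card_less_nth_sorted_list_of_set:
  fixes \<sigma> :: "nat set"
  assumes "finite \<sigma>" "p < card \<sigma>"
  shows "{k \<in> \<sigma>. k < sorted_list_of_set \<sigma> ! p} = set (take p (sorted_list_of_set \<sigma>))"
    and "card {k \<in> \<sigma>. k < sorted_list_of_set \<sigma> ! p} = p"
proof -
  let ?ks = "sorted_list_of_set \<sigma>"
  have sd: "sorted_wrt (<) ?ks" and len: "length ?ks = card \<sigma>" by simp_all
  have nth_less: "?ks ! i < ?ks ! p \<longleftrightarrow> i < p" if "i < card \<sigma>" for i
    using sorted_wrt_nth_less[OF sd, of i p] sorted_wrt_nth_less[OF sd, of p i] that assms(2) len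
    by (cases i p rule: linorder_cases) auto
  have "{k \<in> \<sigma>. k < ?ks ! p} = (!) ?ks ` {0..<p}"
  proof (intro equalityI subsetI)
    fix k assume k: "k \<in> {k \<in> \<sigma>. k < ?ks ! p}"
    then have "k \<in> set ?ks" using assms(1) by simp
    then obtain i where "i < card \<sigma>" "k = ?ks ! i" by (auto simp: in_set_conv_nth len)
    then show "k \<in> (!) ?ks ` {0..<p}" using k nth_less by auto
  next
    fix k assume "k \<in> (!) ?ks ` {0..<p}"
    then obtain i where i: "i < p" "k = ?ks ! i" by auto
    then have "k \<in> set ?ks" using assms(2) len by auto
    then show "k \<in> {k \<in> \<sigma>. k < ?ks ! p}" using i nth_less[of i] assms by simp
  qed
  also have "\<dots> = set (take p ?ks)" using assms(2) by (intro nth_image) simp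
  finally show eq: "{k \<in> \<sigma>. k < ?ks ! p} = set (take p ?ks)" .
  have "distinct (take p ?ks)" by (intro distinct_take) simp
  then show "card {k \<in> \<sigma>. k < ?ks ! p} = p"
    unfolding eq using distinct_card assms(2) len by fastforce
qed

text \<open>Divisibility of all coordinates by the smallest power of two is the case
  \<open>p = 0\<close> of the counting condition.\<close>

lemma mem_X_tau_shift:
  assumes "\<sigma> \<in> FinN"
  shows "x \<in> X_tau ((\<lambda>k. k + 2) ` \<sigma>) \<longleftrightarrow> length x = card \<sigma> \<and>
    (\<forall>p<card \<sigma>. card {j. j < card \<sigma> \<and> \<not> 2 ^ (sorted_list_of_set \<sigma> ! p) dvd x ! j} \<le> p)"
proof -
  have fin: "finite \<sigma>" "0 < card \<sigma>" using assms by (auto simp: FinN_def card_gt_0_iff)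
  have "(\<forall>j<card \<sigma>. 2 ^ (sorted_list_of_set \<sigma> ! 0) dvd x ! j)"
    if "\<forall>p<card \<sigma>. card {j. j < card \<sigma> \<and> \<not> 2 ^ (sorted_list_of_set \<sigma> ! p) dvd x ! j} \<le> p"
  proof -
    from that have "card {j. j < card \<sigma> \<and> \<not> 2 ^ (sorted_list_of_set \<sigma> ! 0) dvd x ! j} = 0"
      using fin(2) by auto
    then show ?thesis by auto
  qed
  then show ?thesis unfolding X_tau_def k_list_shift[OF fin(1)] by auto
qed

lemma zero_in_X_tau: "\<sigma> \<in> FinN \<Longrightarrow> replicate (card \<sigma>) 0 \<in> X_tau ((\<lambda>k. k + 2) ` \<sigma>)"
  by (subst mem_X_tau_shift) (simp_all cong: conj_cong)

text \<open>The families of a forbidden cover induce families on the grids of mesh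
  \<open>2 ^ k\<close>, up to a common scaling, and \<open>uncovered_point\<close> yields a point of
  the component outside all of them. The exponent \<open>k + 1\<close> makes distinct members at
  least \<open>2 * 2 ^ k\<close> apart, strictly more than the mesh.\<close>

theorem image_in_A_set:
  assumes \<sigma>: "\<sigma> \<in> S_fam \<zeta> \<xi>"
  shows "(\<lambda>k. 2 ^ (k + 1)) ` \<sigma> \<in> A_set (X_space \<zeta> \<xi>)"
proof (rule ccontr)
  define \<phi> where "\<phi> = (\<lambda>k. 2 ^ (k + 1) :: nat)"
  define \<tau> where "\<tau> = (\<lambda>k. k + 2) ` \<sigma>"
  define n where "n = card \<sigma>"
  define ks where "ks = sorted_list_of_set \<sigma>"
  \<comment> \<open>Scaling all coordinates by \<open>3 ^ n\<close> makes even the smallest mesh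
    large enough for \<open>uncovered_point\<close>.\<close>
  define M where "M = (3::int) ^ n"
  have F: "\<sigma> \<in> FinN" using \<sigma> S_fam_subset_FinN by blast
  then have fin: "finite \<sigma>" "0 < n" by (auto simp: FinN_def card_gt_0_iff n_def)
  have M: "0 < M" by (simp add: M_def)
  have ks: "length ks = n" "set ks = \<sigma>" using fin by (auto simp: ks_def n_def)
  have ks_mono: "ks ! i \<le> ks ! j" if "i \<le> j" "j < n" for i j
    using that ks(1) sorted_nth_mono[of ks i j] by (simp add: ks_def)
  have \<tau>S: "\<tau> \<in> S_shift \<zeta> \<xi>" using \<sigma> by (simp add: S_shift_def \<tau>_def)
  assume "(\<lambda>k. 2 ^ (k + 1)) ` \<sigma> \<notin> A_set (X_space \<zeta> \<xi>)"
  moreover have "\<phi> ` \<sigma> \<in> FinN" using F by (auto simp: FinN_def \<phi>_def)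
  ultimately obtain \<U> where \<U>: "\<forall>i\<in>\<phi> ` \<sigma>. \<Union> (\<U> i) \<subseteq> X_carrier \<zeta> \<xi> \<and>
      uniformly_bounded (X_space \<zeta> \<xi>) (\<U> i) \<and> r_disjoint (X_space \<zeta> \<xi>) (real i) (\<U> i)"
    and cover: "X_carrier \<zeta> \<xi> \<subseteq> (\<Union>i\<in>\<phi> ` \<sigma>. \<Union> (\<U> i))"
    unfolding A_set_def \<phi>_def[symmetric] mspace_X_space
    by (simp only: mem_Collect_eq not_not simp_thms) (elim exE conjE)
  \<comment> \<open>Undoes the scaling; \<open>W\<close> retains only points whose first
    \<open>n\<close> coordinates are multiples of \<open>M\<close>, for which the division is
    exact.\<close>
  define P where "P z = (\<tau>, map (\<lambda>i. z i div M) [0..<n])" for z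
  define W where "W j = (\<lambda>U. {z. P z \<in> U \<and> (\<forall>i<n. M dvd z i)}) ` \<U> (\<phi> (ks ! j))" for j
  have \<phi>k: "\<phi> (ks ! j) \<in> \<phi> ` \<sigma>" if "j < n" for j using that ks nth_mem by blast
  have rho_P: "\<bar>real_of_int (z i - w i)\<bar> \<le> M * X_dist (P z) (P w)"
    if i: "i < n" and dvd: "M dvd z i" "M dvd w i" for z w i
  proof -
    obtain a b where ab: "z i = M * a" "w i = M * b" using dvd by (auto elim!: dvdE)
    have "i_emb (map (\<lambda>i. z i div M) [0..<n]) i = a" "i_emb (map (\<lambda>i. w i div M) [0..<n]) i = b"
      using i ab M by (simp_all add: i_emb_def)
    then have "\<bar>real_of_int (a - b)\<bar> \<le> X_dist (P z) (P w)"
      using rho_ge[of "map (\<lambda>i. z i div M) [0..<n]" i "map (\<lambda>i. w i div M) [0..<n]"] by (simp add: P_def)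
    then have "M * \<bar>real_of_int (a - b)\<bar> \<le> M * X_dist (P z) (P w)" using M by (intro mult_left_mono) auto
    moreover have "\<bar>real_of_int (z i - w i)\<bar> = M * \<bar>real_of_int (a - b)\<bar>"
      using M by (simp add: ab abs_mult flip: right_diff_distrib)
    ultimately show ?thesis by simp
  qed
  have "\<forall>j\<in>{..<n}. \<exists>R>0. \<forall>U\<in>\<U> (\<phi> (ks ! j)). \<forall>x\<in>U. \<forall>y\<in>U. X_dist x y \<le> R"
  proof
    fix j assume "j \<in> {..<n}"
    then have "uniformly_bounded (X_space \<zeta> \<xi>) (\<U> (\<phi> (ks ! j)))" using \<U> \<phi>k[of j] by blast
    then show "\<exists>R>0. \<forall>U\<in>\<U> (\<phi> (ks ! j)). \<forall>x\<in>U. \<forall>y\<in>U. X_dist x y \<le> R"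
      by (simp add: uniformly_bounded_def)
  qed
  then obtain R where R: "\<forall>j\<in>{..<n}. R j > 0 \<and> (\<forall>U\<in>\<U> (\<phi> (ks ! j)). \<forall>x\<in>U. \<forall>y\<in>U. X_dist x y \<le> R j)"
    using bchoice[of "{..<n}" "\<lambda>j R. R > 0 \<and> (\<forall>U\<in>\<U> (\<phi> (ks ! j)). \<forall>x\<in>U. \<forall>y\<in>U. X_dist x y \<le> R)"]
    by auto
  \<comment> \<open>One diameter bound for the finitely many families.\<close>
  define R' where "R' = (\<Sum>j<n. R j)"
  have R': "R j \<le> R'" if "j < n" for j
    unfolding R'_def using that R by (intro member_le_sum) (auto intro: less_imp_le)
  interpret multigrid_families n "\<lambda>j. M * 2 ^ (ks ! j)" W "\<lceil>M * R'\<rceil>"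
  proof
    show "0 < M * 2 ^ (ks ! j)" for j using M by simp
    show "M * 2 ^ (ks ! i) dvd M * 2 ^ (ks ! j)" if "i \<le> j" "j < n" for i j
      using ks_mono[OF that] by (intro mult_dvd_mono le_imp_power_dvd) auto
    show "\<bar>x i - y i\<bar> \<le> \<lceil>M * R'\<rceil>" if j: "j < n" and U: "U \<in> W j" and xy: "x \<in> U" "y \<in> U" and i: "i < n"
      for j U x y i
    proof -
      obtain U' where U': "U' \<in> \<U> (\<phi> (ks ! j))" "U = {z. P z \<in> U' \<and> (\<forall>i<n. M dvd z i)}"
        using U by (auto simp: W_def)
      have P: "P x \<in> U'" "P y \<in> U'" "M dvd x i" "M dvd y i" using xy i unfolding U'(2) by simp_all
      have "R j > 0 \<and> (\<forall>U\<in>\<U> (\<phi> (ks ! j)). \<forall>x\<in>U. \<forall>y\<in>U. X_dist x y \<le> R j)"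
        using bspec[OF R, of j] j by simp
      then have "X_dist (P x) (P y) \<le> R j" using U'(1) P(1,2) by simp
      then have "X_dist (P x) (P y) \<le> R'" using R'[OF j] by simp
      then have "M * X_dist (P x) (P y) \<le> M * R'" using M by (intro mult_left_mono) auto
      then have "\<bar>real_of_int (x i - y i)\<bar> \<le> M * R'"
        using rho_P[where z = x and w = y, OF i P(3,4)] by simp
      then show ?thesis by linarith
    qed
    show "\<exists>i<n. M * 2 ^ (ks ! j) < \<bar>x i - y i\<bar>"
      if j: "j < n" and UV: "U \<in> W j" "V \<in> W j" "U \<noteq> V" and xy: "x \<in> U" "y \<in> V" for j U V x y
    proof (rule ccontr)
      assume far: "\<not> ?thesis"
      obtain U' V' where U': "U' \<in> \<U> (\<phi> (ks ! j))" "U = {z. P z \<in> U' \<and> (\<forall>i<n. M dvd z i)}"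
        and V': "V' \<in> \<U> (\<phi> (ks ! j))" "V = {z. P z \<in> V' \<and> (\<forall>i<n. M dvd z i)}"
        using UV by (auto simp: W_def)
      have "r_disjoint (X_space \<zeta> \<xi>) (real (\<phi> (ks ! j))) (\<U> (\<phi> (ks ! j)))" using \<U> \<phi>k[OF j] by blast
      moreover have "U' \<noteq> V'" using UV(3) U'(2) V'(2) by (intro notI) simp
      moreover have "P x \<in> U'" "P y \<in> V'" using xy unfolding U'(2) V'(2) by simp_all
      ultimately have "real (\<phi> (ks ! j)) \<le> X_dist (P x) (P y)"
        using U'(1) V'(1) by (simp add: r_disjoint_def)
      moreover have "X_dist (P x) (P y) \<le> 2 ^ (ks ! j)"
        unfolding P_def X_dist.simps if_P[OF refl]
      proof (rule rho_le)
        fix i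
        show "\<bar>real_of_int (i_emb (map (\<lambda>i. x i div M) [0..<n]) i - i_emb (map (\<lambda>i. y i div M) [0..<n]) i)\<bar>
            \<le> 2 ^ (ks ! j)"
        proof (cases "i < n")
          case True
          then have "M dvd x i" "M dvd y i" using xy unfolding U'(2) V'(2) by simp_all
          then obtain a b where ab: "x i = M * a" "y i = M * b" by (auto elim!: dvdE)
          have "\<bar>x i - y i\<bar> \<le> M * 2 ^ (ks ! j)" using far True by auto
          then have "M * \<bar>a - b\<bar> \<le> M * 2 ^ (ks ! j)"
            using M by (simp add: ab abs_mult flip: right_diff_distrib)
          then have "\<bar>a - b\<bar> \<le> 2 ^ (ks ! j)" using M by simp
          then have "real_of_int \<bar>a - b\<bar> \<le> real_of_int (2 ^ (ks ! j))" by (simp only: of_int_le_iff)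
          then show ?thesis using True ab M by (simp add: i_emb_def)
        qed (simp add: i_emb_def)
      qed
      moreover have "real (\<phi> (ks ! j)) = 2 * 2 ^ (ks ! j)" "(0::real) < 2 ^ (ks ! j)"
        by (simp_all add: \<phi>_def)
      ultimately show False by linarith
    qed
  qed
  have large: "3 ^ n \<le> M * 2 ^ (ks ! j)" for j
    using mult_left_mono[of 1 "2 ^ (ks ! j)" M] M by (simp add: M_def)
  from uncovered_point[OF large]
  obtain z where z: "\<forall>p<n. card (off_grid n (M * 2 ^ (ks ! p)) z) \<le> p"
    and z_avoids: "\<forall>p<n. \<forall>U\<in>W p. z \<notin> U"
    by (elim exE conjE)
  \<comment> \<open>Level \<open>0\<close> allows no coordinate off its grid, so \<open>M\<close>
    divides every coordinate of \<open>z\<close> and \<open>P z\<close> is the rescaled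
    point.\<close>
  have "card (off_grid n (M * 2 ^ (ks ! 0)) z) = 0" using spec[OF z, of 0] fin(2) by simp
  then have z0: "M * 2 ^ (ks ! 0) dvd z i" if "i < n" for i using that by (auto simp: off_grid_def)
  have Mz: "M dvd z i" if "i < n" for i using dvd_mult_left[OF z0[OF that]] .
  have off: "{j. j < n \<and> \<not> 2 ^ (ks ! p) dvd map (\<lambda>i. z i div M) [0..<n] ! j} =
      off_grid n (M * 2 ^ (ks ! p)) z" for p
    using Mz M by (auto simp: off_grid_def dvd_div_iff_mult mult.commute)
  have "map (\<lambda>i. z i div M) [0..<n] \<in> X_tau \<tau>"
    unfolding \<tau>_def mem_X_tau_shift[OF F] n_def[symmetric] ks_def[symmetric] off
    using z by simp
  with \<tau>S have "P z \<in> X_carrier \<zeta> \<xi>" unfolding P_def X_carrier_def by (rule SigmaI)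
  with cover have "P z \<in> (\<Union>i\<in>\<phi> ` \<sigma>. \<Union> (\<U> i))" by (rule subsetD)
  then obtain k U where k: "k \<in> \<sigma>" "U \<in> \<U> (\<phi> k)" "P z \<in> U" by (elim UN_E imageE UnionE) simp
  then have "k \<in> set ks" by (simp only: ks)
  then obtain j where j: "j < n" "k = ks ! j" unfolding in_set_conv_nth ks(1) by blast
  have "{z. P z \<in> U \<and> (\<forall>i<n. M dvd z i)} \<in> W j" unfolding W_def using k(2) unfolding j(2) by (rule imageI)
  then have "z \<notin> {z. P z \<in> U \<and> (\<forall>i<n. M dvd z i)}" by (rule z_avoids[rule_format, OF j(1)])
  then show False using k(3) Mz by simp
qed

section \<open>Covering the skeleton of a grid\<close>

definition near_multiple :: "int \<Rightarrow> int \<Rightarrow> int \<Rightarrow> bool"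
  where "near_multiple E c t \<longleftrightarrow> (\<exists>m. \<bar>t - m * E\<bar> \<le> c)"

lemma near_multiple_0: "near_multiple E 0 t \<longleftrightarrow> E dvd t"
  by (auto simp: near_multiple_def dvd_def mult.commute)

lemma near_multiple_shift: "near_multiple E c t \<Longrightarrow> \<bar>t - u\<bar> \<le> d \<Longrightarrow> near_multiple E (c + d) u"
proof -
  assume "near_multiple E c t" "\<bar>t - u\<bar> \<le> d"
  then obtain m where "\<bar>t - m * E\<bar> \<le> c" by (auto simp: near_multiple_def)
  then have "\<bar>u - m * E\<bar> \<le> c + d" using \<open>\<bar>t - u\<bar> \<le> d\<close> by linarith
  then show ?thesis by (auto simp: near_multiple_def)
qed

text \<open>Otherwise a multiple of \<open>E\<close> would lie above \<open>t\<close> and not above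
  \<open>u\<close>, hence within \<open>d\<close> of \<open>u\<close>.\<close>

lemma div_le_if_not_near:
  assumes "0 < E" "\<not> near_multiple E d u" "\<bar>t - u\<bar> \<le> d"
  shows "u div E \<le> t div (E :: int)"
proof (rule ccontr)
  assume "\<not> u div E \<le> t div E"
  then have "t div E + 1 \<le> u div E" by simp
  then have "(t div E + 1) * E \<le> u div E * E" using assms(1) by (intro mult_right_mono) auto
  moreover have "t < t div E * E + E"
    using pos_mod_bound[OF assms(1), of t] div_mult_mod_eq[of t E] by linarith
  then have "t < (t div E + 1) * E" by (simp add: distrib_right)
  moreover have "u div E * E \<le> u"
    using pos_mod_sign[OF assms(1), of u] div_mult_mod_eq[of u E] by linarith
  ultimately have "\<bar>u - u div E * E\<bar> \<le> d" using assms(3) by linarith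
  then show False using assms(2) by (auto simp: near_multiple_def)
qed

text \<open>Both numbers are close to the same multiple of \<open>E\<close>, since distinct
  multiples are too far apart; the shift by \<open>T\<close> places the whole neighbourhood of that
  multiple in one block of length \<open>E\<close>.\<close>

lemma div_eq_if_near:
  assumes "near_multiple E c t" "near_multiple E c u" "\<bar>t - u\<bar> \<le> d" "c \<le> T" "2 * T + d < E"
    "0 \<le> c"
  shows "(t + T) div E = (u + T) div E"
proof -
  obtain m where m: "\<bar>t - m * E\<bar> \<le> c" using assms(1) by (auto simp: near_multiple_def)
  obtain m' where m': "\<bar>u - m' * E\<bar> \<le> c" using assms(2) by (auto simp: near_multiple_def)
  have E: "0 < E" using assms(3-6) by linarith
  have "\<bar>m * E - m' * E\<bar> < E" using m m' assms(3,4,5) by linarith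
  then have "\<bar>m - m'\<bar> * E < 1 * E" using E by (simp add: abs_mult flip: left_diff_distrib)
  then have "\<bar>m - m'\<bar> < 1" using E by (simp only: mult_less_cancel_right_pos)
  then have "m = m'" by simp
  moreover have "(s + T) div E = k" if "\<bar>s - k * E\<bar> \<le> c" for s k
    using that assms(3,4,5) by (intro int_div_pos_eq[of _ _ _ "s + T - k * E"]) (auto simp: algebra_simps)
  ultimately show ?thesis using m m' by simp
qed

lemma abs_diff_if_div_eq:
  assumes "(t + c) div E = (u + c) div E" "0 < (E :: int)"
  shows "\<bar>t - u\<bar> \<le> E"
proof -
  have "t - u = (t + c) mod E - (u + c) mod E"
    using div_mult_mod_eq[of "t + c" E, unfolded assms(1)] div_mult_mod_eq[of "u + c" E] by linarith
  moreover have "0 \<le> (t + c) mod E" "(t + c) mod E < E" "0 \<le> (u + c) mod E" "(u + c) mod E < E"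
    using assms(2) by simp_all
  ultimately show ?thesis by linarith
qed

text \<open>For eventually zero \<open>u\<close> and \<open>c = 0\<close>, a bound on the size of
  this set says that \<open>u\<close> lies in a skeleton of the grid of mesh
  \<open>E\<close>.\<close>

definition far_indices :: "int \<Rightarrow> int \<Rightarrow> (nat \<Rightarrow> int) \<Rightarrow> nat set"
  where "far_indices E c u = {i. \<not> near_multiple E c (u i)}"

lemma far_indices_antimono: "c \<le> d \<Longrightarrow> far_indices E d u \<subseteq> far_indices E c u"
  unfolding far_indices_def near_multiple_def by (auto intro: order_trans)

lemma finite_far_indices: "0 \<le> c \<Longrightarrow> finite (far_indices E c (i_emb x))"
proof (rule finite_subset)
  assume "0 \<le> c"
  then have "near_multiple E c 0" by (auto simp: near_multiple_def intro: exI[of _ 0])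
  then show "far_indices E c (i_emb x) \<subseteq> {..<length x}"
    by (auto simp: far_indices_def i_emb_def not_less split: if_splits)
qed simp

text \<open>A point of the \<open>N\<close>-skeleton of the grid \<open>E\<int>\<close> is put into the class of the least \<open>p\<close> such that
  it is close to the \<open>p\<close>-skeleton; the required closeness decreases with \<open>p\<close>, which
  separates the pieces within one class.\<close>

definition skeleton_class :: "int \<Rightarrow> int \<Rightarrow> nat \<Rightarrow> (nat \<Rightarrow> int) \<Rightarrow> nat"
  where "skeleton_class E D N u = (LEAST p. card (far_indices E (int (N - p) * D) u) \<le> p)"

text \<open>Points of different components can be closer than \<open>r\<close> only if both values
  of \<open>s_val\<close> are below \<open>r\<close>; just these components share the label
  \<open>None\<close>. A far coordinate records its grid interval, a near one the multiple of
  \<open>E\<close> that it is close to.\<close>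

definition piece_label ::
    "real \<Rightarrow> int \<Rightarrow> int \<Rightarrow> nat \<Rightarrow> nat \<Rightarrow> nat set \<times> int list \<Rightarrow> nat set option \<times> nat set \<times> (nat \<Rightarrow> int)"
  where "piece_label r E D N p = (\<lambda>(\<tau>, x).
    (if s_val \<tau> < r then None else Some \<tau>,
     far_indices E (int (N - p) * D) (i_emb x),
     \<lambda>i. if i \<in> far_indices E (int (N - p) * D) (i_emb x) then i_emb x i div E
         else (i_emb x i + int N * D) div E))"

text \<open>At \<open>p = N\<close> the tolerance is \<open>0\<close>, so the hypothesis makes
  \<open>N\<close> a candidate for the minimum.\<close>

lemma skeleton_class:
  assumes "card (far_indices E 0 u) \<le> N"
  shows "skeleton_class E D N u \<le> N"
    and "card (far_indices E (int (N - skeleton_class E D N u) * D) u) \<le> skeleton_class E D N u"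
proof -
  let ?P = "\<lambda>p. card (far_indices E (int (N - p) * D) u) \<le> p"
  have "?P N" using assms by simp
  then show "skeleton_class E D N u \<le> N" "?P (skeleton_class E D N u)"
    unfolding skeleton_class_def by (rule Least_le, rule LeastI)
qed

text \<open>By minimality more than \<open>q\<close> indices are far at the larger tolerance, while
  at most \<open>q + 1\<close> are far at the smaller one. Hence no coordinate has its distance from
  the multiples between the two tolerances.\<close>

lemma far_indices_class_eq:
  assumes "skeleton_class E D N (i_emb x) = Suc q" "card (far_indices E 0 (i_emb x)) \<le> N" "0 \<le> D"
  shows "far_indices E (int (N - Suc q) * D) (i_emb x) = far_indices E (int (N - q) * D) (i_emb x)"
proof -
  have "int (N - Suc q) * D \<le> int (N - q) * D" using assms(3) by (intro mult_right_mono) auto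
  then have sub: "far_indices E (int (N - q) * D) (i_emb x) \<subseteq> far_indices E (int (N - Suc q) * D) (i_emb x)"
    by (rule far_indices_antimono)
  have "\<not> card (far_indices E (int (N - q) * D) (i_emb x)) \<le> q"
    using not_less_Least[of q "\<lambda>p. card (far_indices E (int (N - p) * D) (i_emb x)) \<le> p"] assms(1)
    by (simp add: skeleton_class_def)
  moreover have "card (far_indices E (int (N - Suc q) * D) (i_emb x)) \<le> Suc q"
    using skeleton_class(2)[OF assms(2), of D] assms(1) by simp
  ultimately show ?thesis
    using card_seteq[OF finite_far_indices sub] assms(3) by simp
qed

text \<open>A displacement below \<open>r\<close> changes each coordinate by at most
  \<open>D\<close>, which is too little to cross the gap between consecutive tolerances; so two such
  points have the same far indices and the same quotients.\<close>

lemma piece_label_eq: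
  assumes near: "X_dist (\<tau>, x) (\<tau>', y) < r" and rD: "r \<le> real_of_int D" and D: "0 \<le> D"
    and E: "int (2 * N + 1) * D < E"
    and x: "skeleton_class E D N (i_emb x) = p" "card (far_indices E 0 (i_emb x)) \<le> N"
    and y: "skeleton_class E D N (i_emb y) = p" "card (far_indices E 0 (i_emb y)) \<le> N"
  shows "piece_label r E D N p (\<tau>, x) = piece_label r E D N p (\<tau>', y)"
proof -
  let ?c = "int (N - p) * D"
  have rho: "rho (i_emb x) (i_emb y) < r" using near by (auto split: if_splits)
  have close: "\<bar>i_emb x i - i_emb y i\<bar> \<le> D" "\<bar>i_emb y i - i_emb x i\<bar> \<le> D" for i
  proof -
    have "real_of_int \<bar>i_emb x i - i_emb y i\<bar> \<le> real_of_int D"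
      using rho_ge[of x i y] rho rD by simp
    then show "\<bar>i_emb x i - i_emb y i\<bar> \<le> D" "\<bar>i_emb y i - i_emb x i\<bar> \<le> D"
      by (simp_all only: of_int_le_iff abs_minus_commute)
  qed
  have pN: "p \<le> N" using skeleton_class(1)[OF x(2)] x(1) by blast
  have "0 \<le> ?c" using D by simp
  \<comment> \<open>In class \<open>0\<close> no index is far; in the other classes the gap raises
    the tolerance from \<open>?c\<close> to \<open>?c + D\<close>.\<close>
  have far_D: "\<not> near_multiple E D (i_emb z i) \<and> i \<in> far_indices E (?c + D) (i_emb z)"
    if "i \<in> far_indices E ?c (i_emb z)" "skeleton_class E D N (i_emb z) = p"
      "card (far_indices E 0 (i_emb z)) \<le> N" for i z
  proof (cases p)
    case 0
    then have "card (far_indices E ?c (i_emb z)) = 0" using skeleton_class(2)[OF that(3), of D] that(2) by simp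
    then have "far_indices E ?c (i_emb z) = {}" using finite_far_indices[OF \<open>0 \<le> ?c\<close>] by simp
    then show ?thesis using that(1) by simp
  next
    case (Suc q)
    have "int (N - q) = int (N - p) + 1" using Suc pN by simp
    then have c: "int (N - q) * D = ?c + D" by (simp add: distrib_right)
    have i: "i \<in> far_indices E (?c + D) (i_emb z)"
      using far_indices_class_eq[of E D N z q] that Suc D by (simp add: c)
    moreover have "i \<in> far_indices E D (i_emb z)"
      using i far_indices_antimono[of D "?c + D" E "i_emb z"] \<open>0 \<le> ?c\<close> by auto
    ultimately show ?thesis by (simp add: far_indices_def)
  qed
  have sub: "far_indices E ?c (i_emb z) \<subseteq> far_indices E ?c (i_emb w)"
    if "skeleton_class E D N (i_emb z) = p" "card (far_indices E 0 (i_emb z)) \<le> N"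
      and "\<And>i. \<bar>i_emb w i - i_emb z i\<bar> \<le> D" for z w
  proof
    fix i assume "i \<in> far_indices E ?c (i_emb z)"
    then have "\<not> near_multiple E (?c + D) (i_emb z i)"
      using far_D that(1,2) by (auto simp: far_indices_def)
    then show "i \<in> far_indices E ?c (i_emb w)"
      using near_multiple_shift that(3) by (auto simp: far_indices_def)
  qed
  have far_eq: "far_indices E ?c (i_emb x) = far_indices E ?c (i_emb y)"
    using sub[OF x close(2)] sub[OF y close(1)] by (rule equalityI)
  have T: "?c \<le> int N * D" "2 * (int N * D) + D < E" "0 < E"
    using D E mult_right_mono[of "int (N - p)" "int N" D] by (auto simp: algebra_simps intro: le_less_trans[rotated])
  have "i_emb x i div E = i_emb y i div E" if "i \<in> far_indices E ?c (i_emb x)" for i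
  proof (rule order_antisym)
    have "i \<in> far_indices E ?c (i_emb y)" using that far_eq by simp
    then show "i_emb y i div E \<le> i_emb x i div E"
      using far_D[OF _ y] close T(3) by (intro div_le_if_not_near[of _ D]) auto
    show "i_emb x i div E \<le> i_emb y i div E"
      using far_D[OF that x] close T(3) by (intro div_le_if_not_near[of _ D]) auto
  qed
  moreover have "(i_emb x i + int N * D) div E = (i_emb y i + int N * D) div E"
    if "i \<notin> far_indices E ?c (i_emb x)" for i
  proof (rule div_eq_if_near)
    show "near_multiple E ?c (i_emb x i)" "near_multiple E ?c (i_emb y i)"
      using that far_eq by (auto simp: far_indices_def)
  qed (use close T \<open>0 \<le> ?c\<close> in auto)
  moreover have "(if s_val \<tau> < r then None else Some \<tau>) = (if s_val \<tau>' < r then None else Some \<tau>')"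
    using near by (auto split: if_splits)
  ultimately show ?thesis using far_eq by (auto simp: piece_label_def)
qed

lemma piece_label_bounded:
  assumes eq: "piece_label r E D N p (\<tau>, x) = piece_label r E D N p (\<tau>', y)" and "0 < E" "0 < r"
  shows "X_dist (\<tau>, x) (\<tau>', y) \<le> r + E"
proof -
  let ?I = "far_indices E (int (N - p) * D)"
  have I: "?I (i_emb x) = ?I (i_emb y)" and lab: "(if i \<in> ?I (i_emb x) then i_emb x i div E
      else (i_emb x i + int N * D) div E) = (if i \<in> ?I (i_emb y) then i_emb y i div E
      else (i_emb y i + int N * D) div E)" for i
  proof -
    show "?I (i_emb x) = ?I (i_emb y)" using eq by (simp add: piece_label_def)
    have "snd (snd (piece_label r E D N p (\<tau>, x))) i = snd (snd (piece_label r E D N p (\<tau>', y))) i"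
      by (simp only: eq)
    then show "(if i \<in> ?I (i_emb x) then i_emb x i div E else (i_emb x i + int N * D) div E) =
        (if i \<in> ?I (i_emb y) then i_emb y i div E else (i_emb y i + int N * D) div E)"
      by (simp only: piece_label_def case_prod_conv snd_conv)
  qed
  have "rho (i_emb x) (i_emb y) \<le> E"
  proof (rule rho_le)
    fix i
    have "\<bar>i_emb x i - i_emb y i\<bar> \<le> E"
      using lab[of i] I abs_diff_if_div_eq[of "i_emb x i" 0 E "i_emb y i"]
        abs_diff_if_div_eq[of "i_emb x i" "int N * D" E "i_emb y i"] assms(2)
      by (auto split: if_splits)
    then have "real_of_int \<bar>i_emb x i - i_emb y i\<bar> \<le> real_of_int E" by (simp only: of_int_le_iff)
    then show "\<bar>real_of_int (i_emb x i - i_emb y i)\<bar> \<le> real_of_int E" by simp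
  qed
  moreover have "\<tau> = \<tau>' \<or> s_val \<tau> < r \<and> s_val \<tau>' < r"
    using eq by (auto simp: piece_label_def split: if_splits)
  ultimately show ?thesis using assms(2,3) by auto
qed

text \<open>One family for each class p \<le> N, consisting of the sets of points with a common
  label. The diameter bound \<open>r + E\<close> does not depend on the component.\<close>

lemma skeleton_cover:
  assumes m: "mdist m = X_dist" "G \<subseteq> mspace m"
    and skel: "\<And>\<tau> x. (\<tau>, x) \<in> G \<Longrightarrow> card (far_indices E 0 (i_emb x)) \<le> N"
    and r: "0 < r" "r \<le> real_of_int D" and E: "int (2 * N + 1) * D < E"
  obtains \<U> where "\<forall>i\<le>N. \<Union> (\<U> i) \<subseteq> mspace m \<and> r_disjoint m r (\<U> i) \<and> uniformly_bounded m (\<U> i)"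
    and "(\<Union>i\<le>N. \<Union> (\<U> i)) = G"
proof
  define piece where "piece p c = {z \<in> G. skeleton_class E D N (i_emb (snd z)) = p \<and>
    piece_label r E D N p z = c}" for p c
  let ?\<U> = "\<lambda>p. range (piece p)"
  have D: "0 \<le> D" using r by linarith
  have E0: "0 < E" using E D by (auto intro: le_less_trans[rotated])
  show "\<forall>i\<le>N. \<Union> (?\<U> i) \<subseteq> mspace m \<and> r_disjoint m r (?\<U> i) \<and> uniformly_bounded m (?\<U> i)"
  proof (intro allI impI conjI)
    fix p assume "p \<le> N"
    show "\<Union> (?\<U> p) \<subseteq> mspace m" using m(2) by (auto simp: piece_def)
    have "r \<le> X_dist z w" if "z \<in> piece p c" "w \<in> piece p c'" "c \<noteq> c'" for z w c c'
    proof (rule ccontr)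
      assume "\<not> r \<le> X_dist z w"
      moreover obtain \<tau> x \<tau>' y where "z = (\<tau>, x)" "w = (\<tau>', y)" by (metis surj_pair)
      ultimately have "piece_label r E D N p z = piece_label r E D N p w"
        using that skel piece_label_eq[of \<tau> x \<tau>' y r D N E p] r D E by (auto simp: piece_def)
      then show False using that by (simp add: piece_def)
    qed
    then show "r_disjoint m r (?\<U> p)" unfolding r_disjoint_def m(1) by blast
    have "X_dist z w \<le> r + E" if "z \<in> piece p c" "w \<in> piece p c" for z w c
    proof -
      obtain \<tau> x \<tau>' y where "z = (\<tau>, x)" "w = (\<tau>', y)" by (metis surj_pair)
      then show ?thesis using that piece_label_bounded[of r E D N p \<tau> x \<tau>' y] E0 r by (auto simp: piece_def)
    qed
    then show "uniformly_bounded m (?\<U> p)"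
      unfolding uniformly_bounded_def m(1) using E0 r(1) by (intro exI[of _ "r + E"]) auto
  qed
  show "(\<Union>i\<le>N. \<Union> (?\<U> i)) = G"
    using skeleton_class(1)[OF skel] by (fastforce simp: piece_def)
qed

section \<open>The upper bound\<close>

text \<open>If \<open>k\<close> is the element of \<sigma> at position \<open>p\<close>, at most
  \<open>p\<close> coordinates are not divisible by \<open>2 ^ k\<close>, hence at most
  \<open>p\<close> are not divisible by the smaller power \<open>2 ^ l\<close>.\<close>

lemma card_far_indices_le:
  assumes \<sigma>: "\<sigma> \<in> FinN" and x: "x \<in> X_tau ((\<lambda>k. k + 2) ` \<sigma>)"
  shows "card (far_indices E 0 (i_emb x)) \<le> card \<sigma>"
    and "k \<in> \<sigma> \<Longrightarrow> l \<le> k \<Longrightarrow> card (far_indices (2 ^ l) 0 (i_emb x)) \<le> card {k' \<in> \<sigma>. k' < k}"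
proof -
  have fin: "finite \<sigma>" using \<sigma> by (simp add: FinN_def)
  have len: "length x = card \<sigma>" using x mem_X_tau_shift[OF \<sigma>] by simp
  have far: "far_indices E 0 (i_emb x) = {j. j < card \<sigma> \<and> \<not> E dvd x ! j}" for E
    by (auto simp: far_indices_def near_multiple_0 i_emb_def len)
  have "card {j. j < card \<sigma> \<and> \<not> E dvd x ! j} \<le> card {..<card \<sigma>}"
    by (intro card_mono) auto
  then show "card (far_indices E 0 (i_emb x)) \<le> card \<sigma>" by (simp add: far)
  assume k: "k \<in> \<sigma>" "l \<le> k"
  then have "k \<in> set (sorted_list_of_set \<sigma>)" using fin by simp
  then obtain p where p: "p < card \<sigma>" "sorted_list_of_set \<sigma> ! p = k"
    by (auto simp: in_set_conv_nth)
  have "(2::int) ^ l dvd 2 ^ k" using k(2) by (rule le_imp_power_dvd)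
  then have "card {j. j < card \<sigma> \<and> \<not> 2 ^ l dvd x ! j} \<le> card {j. j < card \<sigma> \<and> \<not> 2 ^ k dvd x ! j}"
    by (intro card_mono) (auto intro: dvd_trans)
  also have "\<dots> \<le> p" using x p mem_X_tau_shift[OF \<sigma>] by auto
  also have "p = card {k' \<in> \<sigma>. k' < k}"
    using card_less_nth_sorted_list_of_set(2)[OF fin p(1)] p(2) by simp
  finally show "card (far_indices (2 ^ l) 0 (i_emb x)) \<le> card {k' \<in> \<sigma>. k' < k}" by (simp add: far)
qed

text \<open>The complements that occur in the recursive bound on the dimension are of this form.\<close>

definition extended_fam :: "(omega1 \<Rightarrow> nat \<Rightarrow> omega1) \<Rightarrow> nat \<Rightarrow> omega1 set \<Rightarrow> nat set set"
  where "extended_fam \<zeta> K B = {\<sigma> \<in> FinN. \<exists>F \<sigma>'. \<sigma> = F \<union> \<sigma>' \<and> F \<subseteq> {1..K} \<and>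
    (\<sigma>' = {} \<or> (\<exists>\<beta>\<in>B. \<sigma>' \<in> S_fam \<zeta> \<beta>))}"

lemma extended_fam_mono:
  "\<sigma> \<in> extended_fam \<zeta> K B \<Longrightarrow> K \<le> K' \<Longrightarrow> B \<subseteq> B' \<Longrightarrow> \<sigma> \<in> extended_fam \<zeta> K' B'"
  unfolding extended_fam_def by fastforce

text \<open>If the element \<open>k\<close> of \<sigma>' at position \<open>n\<close> were at least
  \<open>e\<close>, at most \<open>n + K\<close> indices would lie below it and \<open>x\<close>
  would be in the excluded skeleton. So \<open>k < e\<close>: the elements up to \<open>k\<close>
  can be moved into the bounded set, and the tail lies in a family from one of the first
  \<open>e\<close> terms of the fundamental sequence.\<close>

lemma extended_fam_reduce:
  assumes \<zeta>: "fundamental_seqs \<zeta>" and \<beta>: "limit_part \<beta> = l" "l \<noteq> ord_zero" "finite_part \<beta> \<le> N"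
    and F: "F \<subseteq> {1..K}" and \<sigma>': "\<sigma>' \<in> S_fam \<zeta> \<beta>"
    and x: "x \<in> X_tau ((\<lambda>k. k + 2) ` (F \<union> \<sigma>'))"
    and skel: "\<not> card (far_indices (2 ^ e) 0 (i_emb x)) \<le> N + K"
  shows "F \<union> \<sigma>' \<in> extended_fam \<zeta> (max K e) ((\<lambda>i. ord_plus (\<zeta> l i) i) ` {1..e})"
proof -
  define n where "n = finite_part \<beta>"
  define ks where "ks = sorted_list_of_set \<sigma>'"
  have \<sigma>'F: "\<sigma>' \<in> FinN" using \<sigma>' S_fam_subset_FinN by blast
  then have fin: "finite \<sigma>'" "0 \<notin> \<sigma>'" by (auto simp: FinN_def)
  have finF: "finite F" using F finite_subset by blast
  have cardF: "card F \<le> K" using card_mono[OF _ F] by simp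
  have union: "F \<union> \<sigma>' \<in> FinN" using F \<sigma>'F finF by (auto simp: FinN_def)
  \<comment> \<open>Otherwise \<open>x\<close> has at most \<open>N + K\<close> coordinates and lies
    in the skeleton trivially.\<close>
  have "n < card \<sigma>'"
  proof (rule ccontr)
    assume "\<not> n < card \<sigma>'"
    then have "card (F \<union> \<sigma>') \<le> N + K" using card_Un_le[of F \<sigma>'] cardF \<beta>(3) n_def by linarith
    then show False using card_far_indices_le(1)[OF union x] skel order_trans by blast
  qed
  define k where "k = ks ! n"
  have k: "k \<in> \<sigma>'" using \<open>n < card \<sigma>'\<close> fin(1) nth_mem[of n ks] by (simp add: k_def ks_def)
  have smaller: "{j \<in> \<sigma>'. j < k} = set (take n ks)" "card {j \<in> \<sigma>'. j < k} = n"
    using card_less_nth_sorted_list_of_set[OF fin(1) \<open>n < card \<sigma>'\<close>] by (simp_all add: k_def ks_def)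
  have "k < e"
  proof (rule ccontr)
    assume "\<not> k < e"
    then have "card (far_indices (2 ^ e) 0 (i_emb x)) \<le> card {j \<in> F \<union> \<sigma>'. j < k}"
      using k by (intro card_far_indices_le(2)[OF union x]) auto
    also have "\<dots> \<le> card (F \<union> {j \<in> \<sigma>'. j < k})" using fin finF by (intro card_mono) auto
    also have "\<dots> \<le> card F + n" using card_Un_le[of F "{j \<in> \<sigma>'. j < k}"] smaller(2) by simp
    finally show False using skel cardF \<beta>(3) n_def by linarith
  qed
  have "i_part \<sigma>' n = k" using \<open>n < card \<sigma>'\<close> by (simp add: i_part_def k_def ks_def)
  then obtain i where i: "1 \<le> i" "i \<le> k"
    and K: "K_part \<sigma>' n = {} \<or> K_part \<sigma>' n \<in> S_fam \<zeta> (ord_plus (\<zeta> l i) i)"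
    using \<sigma>' S_fam_infinite[OF \<zeta>, of \<beta> \<sigma>'] \<beta>(1,2) by (auto simp: n_def)
  have "take (n + 1) ks = take n ks @ [k]"
    using \<open>n < card \<sigma>'\<close> by (simp add: take_Suc_conv_app_nth k_def ks_def)
  then have head: "set (take (n + 1) ks) = insert k {j \<in> \<sigma>'. j < k}" using smaller(1) by simp
  have "\<sigma>' = set (take (n + 1) ks @ drop (n + 1) ks)"
    using fin(1) by (simp only: append_take_drop_id ks_def set_sorted_list_of_set)
  then have "\<sigma>' = insert k {j \<in> \<sigma>'. j < k} \<union> K_part \<sigma>' n"
    unfolding set_append head by (simp add: K_part_def ks_def)
  then have "F \<union> \<sigma>' = (F \<union> insert k {j \<in> \<sigma>'. j < k}) \<union> K_part \<sigma>' n" by blast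
  moreover have "F \<union> insert k {j \<in> \<sigma>'. j < k} \<subseteq> {1..max K e}"
  proof -
    have "1 \<le> j \<and> j \<le> e" if "j \<in> insert k {j \<in> \<sigma>'. j < k}" for j
      using that k fin(2) \<open>k < e\<close> by (cases j) auto
    then show ?thesis using F by fastforce
  qed
  moreover have "K_part \<sigma>' n = {} \<or>
      (\<exists>\<beta>'\<in>(\<lambda>i. ord_plus (\<zeta> l i) i) ` {1..e}. K_part \<sigma>' n \<in> S_fam \<zeta> \<beta>')"
    using K i \<open>k < e\<close> by force
  ultimately show ?thesis using union unfolding extended_fam_def by blast
qed

text \<open>Covering the good components at scale \<open>r\<close> leaves components of the same
  kind, with a larger \<open>K\<close> and a finite set of ordinals whose limit parts are below
  \<open>l\<close>. These have a maximum \<open>l' < l\<close>, and adding a natural number to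
  \<open>l'\<close> stays below the limit \<open>l\<close>.\<close>

theorem coasdim_le_extended_fam:
  assumes \<zeta>: "fundamental_seqs \<zeta>"
    and "finite B" "l = ord_zero \<or> limit_ord l"
    and "\<And>\<beta>. \<beta> \<in> B \<Longrightarrow> limit_part \<beta> < l \<or> limit_part \<beta> = l \<and> finite_part \<beta> \<le> N"
    and "T \<subseteq> (\<lambda>\<sigma>. (\<lambda>k. k + 2) ` \<sigma>) ` extended_fam \<zeta> K B"
    and "mspace m = Sigma T X_tau" "mdist m = X_dist"
  shows "coasdim_le m (ord_plus l (N + K))"
  using assms(2-)
proof (induction l arbitrary: B N K T m rule: less_induct)
  case (less l)
  note lp = limit_part_unique[OF less.prems(2), of "N + K"]
  have "\<exists>\<U>. (\<forall>i\<le>N + K. \<Union> (\<U> i) \<subseteq> mspace m \<and> r_disjoint m r (\<U> i) \<and> uniformly_bounded m (\<U> i)) \<and>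
      (let Y = submetric m (mspace m - (\<Union>i\<le>N + K. \<Union> (\<U> i)))
       in mspace Y = {} \<or> (\<exists>\<beta>\<in>{..<l}. coasdim_le Y \<beta>))" if r: "0 < r" for r
  proof -
    define D where "D = \<lceil>r\<rceil>"
    have D: "r \<le> real_of_int D" by (simp add: D_def)
    \<comment> \<open>As \<open>x < 2 ^ x\<close>, the mesh \<open>2 ^ e\<close> exceeds the bound
      required by \<open>skeleton_cover\<close> for dimension \<open>N + K\<close>.\<close>
    define e where "e = nat (int (2 * (N + K) + 1) * D)"
    have e: "int (2 * (N + K) + 1) * D < 2 ^ e"
    proof -
      have "x \<le> int (nat x)" for x by simp
      then show ?thesis unfolding e_def by (rule le_less_trans) (rule of_nat_less_two_power)
    qed
    \<comment> \<open>Components are taken whole, so that the complement is again a union of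
      components.\<close>
    define good where "good = {\<tau> \<in> T. \<forall>x\<in>X_tau \<tau>. card (far_indices (2 ^ e) 0 (i_emb x)) \<le> N + K}"
    obtain \<U> where \<U>: "\<forall>i\<le>N + K. \<Union> (\<U> i) \<subseteq> mspace m \<and> r_disjoint m r (\<U> i) \<and> uniformly_bounded m (\<U> i)"
      "(\<Union>i\<le>N + K. \<Union> (\<U> i)) = Sigma good X_tau"
    proof (rule skeleton_cover[OF less.prems(6) _ _ r D e])
      show "Sigma good X_tau \<subseteq> mspace m" using less.prems(5) by (auto simp: good_def)
      show "card (far_indices (2 ^ e) 0 (i_emb x)) \<le> N + K" if "(\<tau>, x) \<in> Sigma good X_tau" for \<tau> x
        using that by (auto simp: good_def)
    qed
    define Y where "Y = submetric m (mspace m - (\<Union>i\<le>N + K. \<Union> (\<U> i)))"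
    have Y: "mspace Y = Sigma (T - good) X_tau" "mdist Y = X_dist"
      unfolding Y_def \<U>(2) using less.prems(5,6) by (auto simp: good_def)
    \<comment> \<open>Ordinals with smaller limit part persist; those with limit part
      \<open>l\<close> are replaced by the first \<open>e\<close> terms of its fundamental
      sequence.\<close>
    define B' where "B' = {\<beta> \<in> B. limit_part \<beta> < l} \<union> (\<lambda>i. ord_plus (\<zeta> l i) i) ` {1..e}"
    have bad: "\<tau> \<in> (\<lambda>\<sigma>. (\<lambda>k. k + 2) ` \<sigma>) ` extended_fam \<zeta> (max K e) B' \<and> l \<noteq> ord_zero"
      if \<tau>: "\<tau> \<in> T - good" for \<tau>
    proof -
      obtain \<sigma> where \<sigma>: "\<sigma> \<in> extended_fam \<zeta> K B" "\<tau> = (\<lambda>k. k + 2) ` \<sigma>"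
        using \<tau> less.prems(4) by blast
      obtain x where x: "x \<in> X_tau \<tau>" "\<not> card (far_indices (2 ^ e) 0 (i_emb x)) \<le> N + K"
        using \<tau> by (auto simp: good_def)
      obtain F \<sigma>' where F: "\<sigma> = F \<union> \<sigma>'" "F \<subseteq> {1..K}" and \<sigma>': "\<sigma>' = {} \<or> (\<exists>\<beta>\<in>B. \<sigma>' \<in> S_fam \<zeta> \<beta>)"
        and "\<sigma> \<in> FinN" using \<sigma>(1) by (auto simp: extended_fam_def)
      have card: "N + K < card \<sigma>"
        using card_far_indices_le(1)[OF \<open>\<sigma> \<in> FinN\<close>, of x "2 ^ e"] x \<sigma>(2) by simp
      have "card \<sigma> \<le> K + card \<sigma>'"
        using card_Un_le[of F \<sigma>'] card_mono[OF _ F(2)] F(1) by simp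
      then have "N < card \<sigma>'" using card by simp
      then obtain \<beta> where \<beta>: "\<beta> \<in> B" "\<sigma>' \<in> S_fam \<zeta> \<beta>" using \<sigma>' by auto
      show ?thesis
      proof (cases "limit_part \<beta> < l")
        case True
        then have "l \<noteq> ord_zero" using leD[OF ord_zero_le] by auto
        moreover have "\<sigma> \<in> extended_fam \<zeta> (max K e) B'"
          using F \<beta> True \<open>\<sigma> \<in> FinN\<close> unfolding extended_fam_def B'_def by fastforce
        ultimately show ?thesis using \<sigma>(2) by blast
      next
        case False
        then have \<beta>l: "limit_part \<beta> = l" "finite_part \<beta> \<le> N" using less.prems(3)[OF \<beta>(1)] by auto
        have l: "l \<noteq> ord_zero"
        \<comment> \<open>For \<open>l = 0\<close> the sets in question have at most
          \<open>N\<close> elements, so no component is left over.\<close>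
        proof
          assume "l = ord_zero"
          then have "card \<sigma>' \<le> finite_part \<beta>" using \<beta>(2) \<beta>l(1) S_fam_finite by blast
          then show False using \<open>N < card \<sigma>'\<close> \<beta>l(2) by simp
        qed
        have "\<sigma> \<in> extended_fam \<zeta> (max K e) ((\<lambda>i. ord_plus (\<zeta> l i) i) ` {1..e})"
          unfolding F(1) using extended_fam_reduce[OF \<zeta> \<beta>l(1) l \<beta>l(2) F(2) \<beta>(2) _ x(2)] x(1) \<sigma>(2) F(1) by simp
        then have "\<sigma> \<in> extended_fam \<zeta> (max K e) B'" by (rule extended_fam_mono) (auto simp: B'_def)
        then show ?thesis using \<sigma>(2) l by blast
      qed
    qed
    have "mspace Y = {} \<or> (\<exists>\<beta>\<in>{..<l}. coasdim_le Y \<beta>)"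
    proof (cases "T - good = {}")
      case True
      then show ?thesis using Y(1) by (simp only: Sigma_empty1 simp_thms)
    next
      case False
      then have l: "l \<noteq> ord_zero" using bad by blast
      then have lim: "limit_ord l" using less.prems(2) by blast
      have lpl: "limit_part l = l" using limit_part_unique(1)[OF less.prems(2), of 0] by simp
      have finB: "finite B'" using less.prems(1) by (simp add: B'_def)
      have lp_less: "limit_part \<beta> < l" if "\<beta> \<in> B'" for \<beta>
      proof -
        have "limit_part (ord_plus (\<zeta> l i) i) < l" if "1 \<le> i" for i
          using fundamental_seqs_guard[OF \<zeta>, of l i] that l lpl limit_part_le[of "ord_plus (\<zeta> l i) i"] by auto
        then show ?thesis using that by (auto simp: B'_def)
      qed
      \<comment> \<open>Inserting \<open>ord_zero\<close> here, and \<open>0\<close> for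
        \<open>N'\<close>, keeps the maxima meaningful when \<open>B'\<close> is empty.\<close>
      define l' where "l' = Max (insert ord_zero (limit_part ` B'))"
      define N' where "N' = Max (insert 0 (finite_part ` B'))"
      have "l' \<in> insert ord_zero (limit_part ` B')" unfolding l'_def using finB by (intro Max_in) auto
      moreover have "ord_zero < l" using l ord_zero_le[of l] by simp
      ultimately have l': "l' < l" "l' = ord_zero \<or> limit_ord l'"
        using lp_less limit_finite_part(1) by auto
      have "coasdim_le Y (ord_plus l' (N' + max K e))"
      proof (rule less.IH[OF l'(1) finB l'(2)])
        fix \<beta> assume "\<beta> \<in> B'"
        then have "limit_part \<beta> \<le> l'" "finite_part \<beta> \<le> N'"
          using finB by (auto simp: l'_def N'_def)
        then show "limit_part \<beta> < l' \<or> limit_part \<beta> = l' \<and> finite_part \<beta> \<le> N'" by auto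
      next
        show "T - good \<subseteq> (\<lambda>\<sigma>. (\<lambda>k. k + 2) ` \<sigma>) ` extended_fam \<zeta> (max K e) B'" using bad by blast
      qed (fact Y)+
      moreover have "ord_plus l' (N' + max K e) < l" using limit_ord_plus_less[OF lim l'(1)] .
      ultimately show ?thesis by blast
    qed
    then show ?thesis using \<U>(1) unfolding Y_def Let_def by (intro exI[of _ \<U>] conjI)
  qed
  then show ?case by (subst coasdim_le.simps) (simp only: lp, blast)
qed

theorem theorem3p3:
  fixes \<xi> :: omega1 and \<zeta> :: "omega1 \<Rightarrow> nat \<Rightarrow> omega1"
  assumes "fundamental_seqs \<zeta>"
    and "ord_plus ord_zero 1 \<le> \<xi>"
  shows "has_coasdim (X_space \<zeta> \<xi>) \<xi> \<and> has_trasdim (X_space \<zeta> \<xi>) \<xi>"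
proof -
  let ?X = "X_space \<zeta> \<xi>"
  have "ord_zero < \<xi>" using less_le_trans[OF ord_succ_greater[of ord_zero]] assms(2) by simp
  then have "\<xi> \<noteq> ord_zero" by blast
  then have one: "{1} \<in> S_fam \<zeta> \<xi>" by (rule singleton_in_S_fam[OF assms(1)]) simp
  \<comment> \<open>The family itself is the case \<open>K = 0\<close>, with nothing added.\<close>
  have fam: "S_fam \<zeta> \<xi> \<subseteq> extended_fam \<zeta> 0 {\<xi>}"
    using S_fam_subset_FinN by (auto simp: extended_fam_def)
  have "coasdim_le ?X (ord_plus (limit_part \<xi>) (finite_part \<xi> + 0))"
  proof (rule coasdim_le_extended_fam[OF assms(1), of "{\<xi>}"])
    show "S_shift \<zeta> \<xi> \<subseteq> (\<lambda>\<sigma>. (\<lambda>k. k + 2) ` \<sigma>) ` extended_fam \<zeta> 0 {\<xi>}"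
      unfolding S_shift_def using fam by (rule image_mono)
  qed (use limit_finite_part(1)[of \<xi>] in \<open>simp_all add: X_carrier_def\<close>)
  then have upper: "coasdim_le ?X \<xi>" by (simp add: limit_finite_part(2))
  have lower: "\<xi> \<le> \<beta>" if "Ord_le (A_set ?X) \<beta>" for \<beta>
  proof (rule Ord_le_S_fam_image[OF assms(1) _ _ _ that])
    show "inj (\<lambda>k. 2 ^ (k + 1) :: nat)" by (rule injI) simp
    show "(\<lambda>k. 2 ^ (k + 1)) ` \<sigma> \<in> A_set ?X" if "\<sigma> \<in> S_fam \<zeta> \<xi>" for \<sigma>
      using that by (rule image_in_A_set)
  qed simp
  \<comment> \<open>The component of the singleton \<open>{1}\<close> contains a point, which
    excludes the value \<open>-1\<close>.\<close>
  have "(((\<lambda>k. k + 2) ` {1}), replicate (card {1 :: nat}) 0) \<in> X_carrier \<zeta> \<xi>"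
    unfolding X_carrier_def
  proof (rule SigmaI)
    show "(\<lambda>k. k + 2) ` {1} \<in> S_shift \<zeta> \<xi>" unfolding S_shift_def using one by (rule imageI)
    show "replicate (card {1 :: nat}) 0 \<in> X_tau ((\<lambda>k. k + 2) ` {1})"
      using one S_fam_subset_FinN by (intro zero_in_X_tau) blast
  qed
  then have "mspace ?X \<noteq> {}" by auto
  \<comment> \<open>A smaller bound for coasdim would also bound trasdim, against
    \<open>lower\<close>.\<close>
  moreover have "\<not> coasdim_le ?X \<beta>" "\<not> Ord_le (A_set ?X) \<beta>" if "\<beta> < \<xi>" for \<beta>
    using that lower coasdim_le_imp_Ord_le[of ?X \<beta>] leD by blast+
  ultimately show ?thesis
    using upper coasdim_le_imp_Ord_le[OF upper] by (auto simp: has_coasdim_def has_trasdim_def has_Ord_def)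
qed

end
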